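(* Every tournament with minimum outdegree at least $6$ contains three pairwise vertex-disjoint (directed) cycles of pairwise different lengths. Moreover, the bound $6$ is sharp: there exists a tournament with minimum outdegree $5$ that does not contain three pairwise vertex-disjoint cycles of pairwise different lengths.
   Context: A tournament is an orientation of a finite complete graph (exactly one arc between every two distinct vertices). Cycles are directed cycles. *)

theory Defs
  imports Main
begin

definition tournament :: "'a set \<Rightarrow> ('a \<Rightarrow> 'a \<Rightarrow> bool) \<Rightarrow> bool" where
  "tournament V E \<longleftrightarrow> finite V \<and> V \<noteq> {} \<and>
     (\<forall>x y. E x y \<longrightarrow> x \<in> V \<and> y \<in> V \<and> x \<noteq> y) \<and>
     (\<forall>x\<in>V. \<forall>y\<in>V. x \<noteq> y \<longrightarrow> (E x y \<longleftrightarrow> \<not> E y x))"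

definition outdeg :: "'a set \<Rightarrow> ('a \<Rightarrow> 'a \<Rightarrow> bool) \<Rightarrow> 'a \<Rightarrow> nat" where
  "outdeg V E v = card {w \<in> V. E v w}"

definition is_cycle :: "'a set \<Rightarrow> ('a \<Rightarrow> 'a \<Rightarrow> bool) \<Rightarrow> 'a list \<Rightarrow> bool" where
  "is_cycle V E c \<longleftrightarrow> length c \<ge> 2 \<and> distinct c \<and> set c \<subseteq> V \<and>
     (\<forall>i < length c. E (c ! i) (c ! ((i + 1) mod length c)))"

definition three_disjoint_cycles_diff_lengths :: "'a set \<Rightarrow> ('a \<Rightarrow> 'a \<Rightarrow> bool) \<Rightarrow> bool" where
  "three_disjoint_cycles_diff_lengths V E \<longleftrightarrow>
     (\<exists>c1 c2 c3. is_cycle V E c1 \<and> is_cycle V E c2 \<and> is_cycle V E c3 \<and>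
        set c1 \<inter> set c2 = {} \<and> set c1 \<inter> set c3 = {} \<and> set c2 \<inter> set c3 = {} \<and>
        length c1 \<noteq> length c2 \<and> length c1 \<noteq> length c3 \<and> length c2 \<noteq> length c3)"

end

theory Submission
  imports Defs
begin

text \<open>
  Remove a triangle \<open>T\<close> and let \<open>K\<close> be a sink component of the rest: \<open>K\<close> is strong and has minimum
  outdegree at least \<open>3\<close>, hence at least \<open>7\<close> vertices.

  If \<open>K\<close> has \<open>7\<close> or \<open>8\<close> vertices, counting arcs shows that nearly all arcs between \<open>K\<close> and \<open>T\<close>
  point to \<open>T\<close>, so \<open>T\<close> must send many arcs to the set \<open>U\<close> of the remaining vertices, which dominates
  \<open>K\<close>. Besides a 5-cycle inside \<open>K\<close> there are then a 4-cycle and a triangle running through \<open>T\<close>, \<open>U\<close>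
  and \<open>K\<close>.

  If \<open>K\<close> has at least \<open>9\<close> vertices, it contains a disjoint 4-cycle and 5-cycle. Fix a 5-cycle \<open>S\<close>
  in \<open>K\<close>. If \<open>X = K - S\<close> has no 4-cycle, its strong components are points and triangles. Only the last
  few components of \<open>X\<close> and the arcs from \<open>S\<close> into the other vertices of \<open>X\<close> matter: this leaves six
  configurations on at most ten vertices plus one set of vertices treated as a single block, each of
  which is refuted by a case distinction on the directions of single arcs.

  The bound is sharp because three such cycles need \<open>3 + 4 + 5 = 12\<close> vertices, while the rotational
  tournament on \<open>11\<close> vertices has all outdegrees equal to \<open>5\<close>.
\<close>

section \<open>Cycles in strong tournaments\<close>

lemma is_cycle_3:
  "is_cycle W E [a, b, c] \<longleftrightarrow>
     distinct [a, b, c] \<and> {a, b, c} \<subseteq> W \<and> E a b \<and> E b c \<and> E c a"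
  by (auto simp: is_cycle_def All_less_Suc)

lemma is_cycle_4:
  "is_cycle W E [a, b, c, d] \<longleftrightarrow>
     distinct [a, b, c, d] \<and> {a, b, c, d} \<subseteq> W \<and> E a b \<and> E b c \<and> E c d \<and> E d a"
  by (auto simp: is_cycle_def All_less_Suc)

lemma is_cycle_5:
  "is_cycle W E [a, b, c, d, e] \<longleftrightarrow>
     distinct [a, b, c, d, e] \<and> {a, b, c, d, e} \<subseteq> W \<and>
     E a b \<and> E b c \<and> E c d \<and> E d e \<and> E e a"
  by (auto simp: is_cycle_def All_less_Suc)

lemma is_cycle_mono: "is_cycle W E c \<Longrightarrow> W \<subseteq> W' \<Longrightarrow> is_cycle W' E c"
  by (auto simp: is_cycle_def)

text \<open>The target for a large sink component: with the removed triangle such a pair realises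
  the lengths 3, 4, 5.\<close>

definition disjoint_cycles_4_5 :: "'a set \<Rightarrow> ('a \<Rightarrow> 'a \<Rightarrow> bool) \<Rightarrow> bool" where
  "disjoint_cycles_4_5 W E \<longleftrightarrow>
     (\<exists>c d. is_cycle W E c \<and> is_cycle W E d \<and> length c = 4 \<and> length d = 5 \<and> set c \<inter> set d = {})"

text \<open>Strong connectivity stated through cuts instead of paths, so that each use directly
  yields an arc leaving a chosen set. Singletons qualify.\<close>

definition strong :: "('a \<Rightarrow> 'a \<Rightarrow> bool) \<Rightarrow> 'a set \<Rightarrow> bool" where
  "strong E W \<longleftrightarrow> W \<noteq> {} \<and> (\<forall>A. A \<noteq> {} \<and> A \<subset> W \<longrightarrow> (\<exists>a\<in>A. \<exists>b\<in>W - A. E a b))"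

lemma strongD: "strong E W \<Longrightarrow> A \<noteq> {} \<Longrightarrow> A \<subset> W \<Longrightarrow> \<exists>a\<in>A. \<exists>b\<in>W - A. E a b"
  unfolding strong_def by blast

text \<open>Hall's condition for two sets. It later supplies distinct vertices of the triangle and
  distinct vertices of \<open>U\<close>.\<close>

lemma exists_distinct_representatives:
  fixes A B :: "'a set"
  assumes "1 \<le> card A" "1 \<le> card B" "2 \<le> card A \<or> 2 \<le> card B"
  obtains x y where "x \<in> A" "y \<in> B" "x \<noteq> y"
proof -
  have large: "\<exists>x\<in>C. x \<noteq> y" if "2 \<le> card C" for C :: "'a set" and y
  proof (rule ccontr)
    assume "\<not> ?thesis"
    then have "C \<subseteq> {y}"
      by blast
    then have "card C \<le> card {y}"
      by (intro card_mono) auto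
    then show False
      using that by simp
  qed
  show thesis
  proof (cases "2 \<le> card A")
    case True
    obtain y where "y \<in> B"
      using assms(2) by fastforce
    then show ?thesis
      using large[OF True, of y] that by blast
  next
    case False
    then have "2 \<le> card B"
      using assms(3) by simp
    moreover obtain x where "x \<in> A"
      using assms(1) by fastforce
    ultimately show ?thesis
      using large[of B x] that by blast
  qed
qed

section \<open>Sink components and short cycles in a tournament\<close>

locale tournament_graph =
  fixes V :: "'a set" and E :: "'a \<Rightarrow> 'a \<Rightarrow> bool"
  assumes tournament: "tournament V E"
begin

lemma finite_V: "finite V"
  and arc_total: "x \<in> V \<Longrightarrow> y \<in> V \<Longrightarrow> x \<noteq> y \<Longrightarrow> E x y \<or> E y x"
  and arc_asym: "E x y \<Longrightarrow> \<not> E y x"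
  and arc_irrefl: "\<not> E x x"
  using tournament unfolding tournament_def by (blast+)

lemma finite_subset_V: "W \<subseteq> V \<Longrightarrow> finite W"
  using finite_V finite_subset by blast

text \<open>Take a smallest nonempty \<open>W\<close> that no arc leaves inside \<open>X\<close>.
  Since arcs are total, having no arc to \<open>x\<close> means being dominated by
  \<open>x\<close>.\<close>

lemma sink_component:
  assumes "X \<subseteq> V" "X \<noteq> {}"
  obtains W where "W \<subseteq> X" "strong E W" "\<And>w x. w \<in> W \<Longrightarrow> x \<in> X - W \<Longrightarrow> E x w"
proof -
  let ?closed = "\<lambda>W. W \<subseteq> X \<and> W \<noteq> {} \<and> (\<forall>w\<in>W. \<forall>x\<in>X - W. \<not> E w x)"
  have "?closed X"
    using assms by blast
  then obtain W where W: "?closed W" and least: "\<And>A. ?closed A \<Longrightarrow> card W \<le> card A"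
    using ex_has_least_nat[of ?closed X card] by blast
  have "strong E W"
    unfolding strong_def
  proof (intro conjI allI impI)
    fix A assume A: "A \<noteq> {} \<and> A \<subset> W"
    show "\<exists>a\<in>A. \<exists>b\<in>W - A. E a b"
    proof (rule ccontr)
      assume "\<not> ?thesis"
      \<comment> \<open>A part of \<open>W\<close> without arcs to the rest of \<open>W\<close> is
        closed in all of \<open>X\<close>, because \<open>W\<close> is, and this contradicts
        minimality.\<close>
      then have "?closed A"
        using A W by blast
      then have "card W \<le> card A"
        by (rule least)
      moreover have "card A < card W"
        using A W assms(1) finite_subset_V[of W] psubset_card_mono[of W A] by blast
      ultimately show False
        by simp
    qed
  qed (use W in blast)
  moreover have "E x w" if "w \<in> W" "x \<in> X - W" for w x
  proof -
    have "\<not> E w x" "x \<in> V" "w \<in> V" "x \<noteq> w"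
      using that W assms(1) by auto
    then show ?thesis
      using arc_total by blast
  qed
  ultimately show thesis
    using that[of W] W by simp
qed

text \<open>An arc \<open>x y\<close> leaving the out-neighbourhood of \<open>v\<close> ends neither
  in that neighbourhood nor, by asymmetry, at \<open>v\<close>; hence \<open>y\<close> points back
  to \<open>v\<close>.\<close>

lemma strong_triangle:
  assumes "strong E W" "W \<subseteq> V" "v \<in> W" "W \<noteq> {v}"
  obtains a b c where "is_cycle W E [a, b, c]"
proof -
  let ?A = "{w \<in> W. E v w}"
  obtain a where a: "a \<in> W" "E v a"
    using strongD[OF assms(1), of "{v}"] assms by blast
  have "?A \<subset> W"
    using assms(3) arc_irrefl by blast
  then obtain x y where xy: "x \<in> ?A" "y \<in> W - ?A" "E x y"
    using strongD[OF assms(1), of ?A] a by blast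
  then have "y \<noteq> v"
    using arc_asym by blast
  then have "E y v"
    using xy assms(2,3) arc_total by blast
  then have "is_cycle W E [v, x, y]"
    using xy assms(3) arc_irrefl by (auto simp: is_cycle_3)
  then show thesis
    by (rule that)
qed

text \<open>Lengthens a cycle \<open>C\<close> into which no vertex can be inserted: a detour through the arc \<open>x y\<close>
  replaces one vertex of \<open>C\<close>.\<close>

lemma strong_detour:
  assumes W: "strong E W" and C: "C \<subset> W" "C \<noteq> {}"
    and out: "\<And>v. v \<in> W - C \<Longrightarrow> (\<forall>c\<in>C. E v c) \<or> (\<forall>c\<in>C. E c v)"
  obtains x y where "x \<in> W - C" "y \<in> W - C" "E x y" "\<forall>c\<in>C. E c x" "\<forall>c\<in>C. E y c"
proof -
  let ?O = "{v \<in> W - C. \<forall>c\<in>C. E c v}" and ?I = "{v \<in> W - C. \<forall>c\<in>C. E v c}"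
  have cover: "W - C = ?O \<union> ?I"
    using out by blast
  \<comment> \<open>Were every outside vertex dominated by \<open>C\<close>, no arc could lead from
    outside back into \<open>C\<close>.\<close>
  have "?I \<noteq> {}"
  proof
    assume "?I = {}"
    then have "?O = W - C"
      using cover by blast
    then obtain a b where "a \<in> ?O" "b \<in> C" "E a b"
      using strongD[OF W, of ?O] C by blast
    then show False
      using arc_asym by blast
  qed
  \<comment> \<open>An arc leaving \<open>C \<union> ?O\<close> ends in \<open>?I\<close>, and it
    cannot start in \<open>C\<close>, since \<open>?I\<close> dominates \<open>C\<close>. So it runs
    from \<open>?O\<close> to \<open>?I\<close>, as wanted.\<close>
  then have "C \<union> ?O \<subset> W"
    using C arc_asym by blast
  then obtain a b where ab: "a \<in> C \<union> ?O" "b \<in> W - (C \<union> ?O)" "E a b"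
    using strongD[OF W, of "C \<union> ?O"] C by blast
  then have b: "b \<in> ?I"
    using cover by blast
  then have "a \<notin> C"
    using ab(3) arc_asym by blast
  then show thesis
    using that[of a b] ab b by blast
qed

text \<open>Either some vertex fits between two consecutive vertices of the triangle, or the detour
  \<open>x y\<close> replaces \<open>c\<close>.\<close>

lemma strong_4_cycle:
  assumes "strong E W" "W \<subseteq> V" "is_cycle W E [a, b, c]" "W \<noteq> {a, b, c}"
  obtains p q r s where "is_cycle W E [p, q, r, s]"
proof (cases "\<exists>v\<in>W - {a, b, c}. is_cycle W E [a, v, b, c] \<or> is_cycle W E [b, v, c, a] \<or>
    is_cycle W E [c, v, a, b]")
  case True
  then show ?thesis
    using that by blast
next
  case False
  \<comment> \<open>If the arcs between \<open>v\<close> and the triangle had mixed directions, some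
    vertex pointing to \<open>v\<close> would be followed by one that \<open>v\<close> points to,
    and \<open>v\<close> could be inserted there.\<close>
  have out: "(\<forall>c\<in>{a, b, c}. E v c) \<or> (\<forall>c\<in>{a, b, c}. E c v)" if v: "v \<in> W - {a, b, c}" for v
  proof -
    have "E v x \<or> E x v" if "x \<in> {a, b, c}" for x
      using arc_total[of v x] v that assms(2,3) by (auto simp: is_cycle_3)
    then show ?thesis
      using False v assms(3) unfolding is_cycle_3 is_cycle_4 by simp blast
  qed
  have "{a, b, c} \<subset> W"
    using assms(3,4) by (auto simp: is_cycle_3)
  then obtain x y where "x \<in> W - {a, b, c}" "y \<in> W - {a, b, c}" "E x y"
    "\<forall>v\<in>{a, b, c}. E v x" "\<forall>v\<in>{a, b, c}. E y v"
    using strong_detour[OF assms(1) _ _ out] by (metis empty_not_insert)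
  then have "is_cycle W E [y, a, b, x]"
    using assms(3) arc_irrefl by (auto simp: is_cycle_3 is_cycle_4)
  then show ?thesis
    by (rule that)
qed

text \<open>The same alternative as for triangles: insertion, or a detour that replaces
  \<open>d\<close>.\<close>

lemma strong_5_cycle:
  assumes "strong E W" "W \<subseteq> V" "is_cycle W E [a, b, c, d]" "W \<noteq> {a, b, c, d}"
  obtains p q r s t where "is_cycle W E [p, q, r, s, t]"
proof (cases "\<exists>v\<in>W - {a, b, c, d}. is_cycle W E [a, v, b, c, d] \<or> is_cycle W E [b, v, c, d, a] \<or>
    is_cycle W E [c, v, d, a, b] \<or> is_cycle W E [d, v, a, b, c]")
  case True
  then show ?thesis
    using that by blast
next
  case False
  have out: "(\<forall>c\<in>{a, b, c, d}. E v c) \<or> (\<forall>c\<in>{a, b, c, d}. E c v)"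
    if v: "v \<in> W - {a, b, c, d}" for v
  proof -
    have "E v x \<or> E x v" if "x \<in> {a, b, c, d}" for x
      using arc_total[of v x] v that assms(2,3) by (auto simp: is_cycle_4)
    then show ?thesis
      using False v assms(3) unfolding is_cycle_4 is_cycle_5 by simp blast
  qed
  have "{a, b, c, d} \<subset> W"
    using assms(3,4) by (auto simp: is_cycle_4)
  then obtain x y where "x \<in> W - {a, b, c, d}" "y \<in> W - {a, b, c, d}" "E x y"
    "\<forall>v\<in>{a, b, c, d}. E v x" "\<forall>v\<in>{a, b, c, d}. E y v"
    using strong_detour[OF assms(1) _ _ out] by (metis empty_not_insert)
  then have "is_cycle W E [y, a, b, c, x]"
    using assms(3) arc_irrefl by (auto simp: is_cycle_4 is_cycle_5)
  then show ?thesis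
    by (rule that)
qed

lemma strong_card_ge_5_cycle:
  assumes "strong E W" "W \<subseteq> V" "5 \<le> card W"
  obtains p q r s t where "is_cycle W E [p, q, r, s, t]"
proof -
  obtain v where v: "v \<in> W"
    using assms(1) by (auto simp: strong_def)
  have "W \<noteq> {v}"
    using assms(3) by auto
  then obtain a b c where abc: "is_cycle W E [a, b, c]"
    using strong_triangle[OF assms(1,2) v] by blast
  have small: "W \<noteq> set xs" if "length xs < 5" for xs
    using assms(3) card_length[of xs] that by auto
  have "W \<noteq> {a, b, c}"
    using small[of "[a, b, c]"] by simp
  then obtain p q r s where pqrs: "is_cycle W E [p, q, r, s]"
    using strong_4_cycle[OF assms(1,2) abc] by blast
  have "W \<noteq> {p, q, r, s}"
    using small[of "[p, q, r, s]"] by simp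
  then show thesis
    using strong_5_cycle[OF assms(1,2) pqrs] that by blast
qed

text \<open>A sink component with more than one vertex contains a triangle. If it were larger than
  that triangle, it would contain a 4-cycle.\<close>

lemma sink_point_or_triangle:
  assumes "X \<subseteq> V" "X \<noteq> {}" "\<And>a b c d. \<not> is_cycle X E [a, b, c, d]"
  shows "(\<exists>y\<in>X. \<forall>x\<in>X - {y}. E x y) \<or>
    (\<exists>a b c. is_cycle X E [a, b, c] \<and> (\<forall>x\<in>X - {a, b, c}. E x a \<and> E x b \<and> E x c))"
proof -
  obtain W where W: "W \<subseteq> X" "strong E W" "\<And>w x. w \<in> W \<Longrightarrow> x \<in> X - W \<Longrightarrow> E x w"
    using sink_component[OF assms(1,2)] by blast
  obtain y where y: "y \<in> W"
    using W(2) by (auto simp: strong_def)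
  show ?thesis
  proof (cases "W = {y}")
    case True
    have "E x y" if "x \<in> X - {y}" for x
      using W(3)[OF y] that True by simp
    then show ?thesis
      using W(1) y by blast
  next
    case False
    have WV: "W \<subseteq> V"
      using W(1) assms(1) by blast
    obtain a b c where abc: "is_cycle W E [a, b, c]"
      using strong_triangle[OF W(2) WV y False] by blast
    have eq: "W = {a, b, c}"
      using strong_4_cycle[OF W(2) WV abc] assms(3) is_cycle_mono[OF _ W(1)] by metis
    have "E x a \<and> E x b \<and> E x c" if "x \<in> X - {a, b, c}" for x
      using W(3)[of _ x] that eq by simp
    then show ?thesis
      using is_cycle_mono[OF abc W(1)] by blast
  qed
qed

text \<open>Outdegrees and indegrees inside \<open>W\<close> have the same sum, and at each vertex
  they add up to \<open>card W - 1\<close>.\<close>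

lemma sum_outdeg:
  assumes "W \<subseteq> V"
  shows "2 * (\<Sum>v\<in>W. card {w \<in> W. E v w}) = card W * (card W - 1)"
proof -
  have fin: "finite W"
    using assms by (rule finite_subset_V)
  have "(\<Sum>v\<in>W. card {w \<in> W. E v w}) = (\<Sum>v\<in>W. card {w \<in> W. E w v})"
    using fin sum.swap_restrict[of W W "\<lambda>_ _. 1::nat" E] by simp
  then have "2 * (\<Sum>v\<in>W. card {w \<in> W. E v w}) =
      (\<Sum>v\<in>W. card {w \<in> W. E v w} + card {w \<in> W. E w v})"
    by (simp add: sum.distrib)
  also have "\<dots> = (\<Sum>v\<in>W. card W - 1)"
  proof (rule sum.cong)
    fix v assume v: "v \<in> W"
    have "card {w \<in> W. E v w} + card {w \<in> W. E w v} = card ({w \<in> W. E v w} \<union> {w \<in> W. E w v})"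
      using fin arc_asym by (subst card_Un_disjoint) auto
    also have "{w \<in> W. E v w} \<union> {w \<in> W. E w v} = W - {v}"
      using v assms arc_total arc_irrefl by blast
    finally show "card {w \<in> W. E v w} + card {w \<in> W. E w v} = card W - 1"
      using v by simp
  qed simp
  finally show ?thesis
    by simp
qed

text \<open>Allows a prescribed vertex to be the first one, as the certificates require of position
  0.\<close>

lemma rotate_5_cycle:
  assumes cyc: "is_cycle W E [a, b, c, d, e]" and "s \<in> {a, b, c, d, e}"
  obtains p q r t where "is_cycle W E [s, p, q, r, t]" "{s, p, q, r, t} = {a, b, c, d, e}"
proof -
  consider "s = a" | "s = b" | "s = c" | "s = d" | "s = e"
    using assms(2) by blast
  then show thesis
  proof cases
    case 1
    show ?thesis
      by (rule that[of b c d e]) (use 1 cyc in \<open>auto simp: is_cycle_5\<close>)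
  next
    case 2
    show ?thesis
      by (rule that[of c d e a]) (use 2 cyc in \<open>auto simp: is_cycle_5\<close>)
  next
    case 3
    show ?thesis
      by (rule that[of d e a b]) (use 3 cyc in \<open>auto simp: is_cycle_5\<close>)
  next
    case 4
    show ?thesis
      by (rule that[of e a b c]) (use 4 cyc in \<open>auto simp: is_cycle_5\<close>)
  next
    case 5
    show ?thesis
      by (rule that[of a b c d]) (use 5 cyc in \<open>auto simp: is_cycle_5\<close>)
  qed
qed

lemma rotate_triangle:
  assumes cyc: "is_cycle W E [a, b, c]" and "s \<in> {a, b, c}"
  obtains p q where "is_cycle W E [s, p, q]" "{s, p, q} = {a, b, c}"
proof -
  consider "s = a" | "s = b" | "s = c"
    using assms(2) by blast
  then show thesis
  proof cases
    case 1
    show ?thesis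
      by (rule that[of b c]) (use 1 cyc in \<open>auto simp: is_cycle_3\<close>)
  next
    case 2
    show ?thesis
      by (rule that[of c a]) (use 2 cyc in \<open>auto simp: is_cycle_3\<close>)
  next
    case 3
    show ?thesis
      by (rule that[of a b]) (use 3 cyc in \<open>auto simp: is_cycle_3\<close>)
  qed
qed

end

section \<open>Certificates for finite case distinctions\<close>

text \<open>
  A certificate refers to vertices by their position in a list \<open>xs\<close> of at most ten vertices; the
  number \<open>10\<close> stands for a whole set \<open>P\<close> of further vertices. The pair \<open>(i, 10)\<close> says that \<open>xs ! i\<close> has an
  out-neighbour in \<open>P\<close>, its converse \<open>(10, i)\<close> that all of \<open>P\<close> dominates \<open>xs ! i\<close>. \<open>Sp i j\<close> splits on the
  direction of an arc, \<open>Cy\<close> closes a branch by a 4-cycle and a 5-cycle, where \<open>10\<close> may only occur as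
  the last vertex of a cycle, and \<open>Dg v\<close> closes a branch because \<open>xs ! v\<close> has fewer than three
  possible out-neighbours.
\<close>

datatype cert =
    Sp nat nat cert cert
  | Cy nat nat nat nat nat nat nat nat nat
  | Dg nat

text \<open>\<open>ps\<close> collects the arcs known on the current branch. Distinctness of all
  nine positions in \<open>Cy\<close> means that at most one of the two cycles uses
  \<open>10\<close>, so one vertex of \<open>P\<close> suffices.\<close>

fun check :: "nat \<Rightarrow> (nat \<times> nat) list \<Rightarrow> cert \<Rightarrow> bool" where
  "check n ps (Sp i j s t) \<longleftrightarrow> i \<noteq> j \<and> (i < n \<or> i = 10) \<and> (j < n \<or> j = 10) \<and>
     check n ((i, j) # ps) s \<and> check n ((j, i) # ps) t"
| "check n ps (Cy a b c d e f g h i) \<longleftrightarrow>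
     list_all (\<lambda>x. x < n) [a, b, c, e, f, g, h] \<and> (d < n \<or> d = 10) \<and> (i < n \<or> i = 10) \<and>
     distinct [a, b, c, d, e, f, g, h, i] \<and>
     list_all (\<lambda>x. x \<in> set ps) [(a, b), (b, c), (c, d), (d, a), (e, f), (f, g), (g, h), (h, i), (i, e)]"
| "check n ps (Dg v) \<longleftrightarrow> v < n \<and> (10, v) \<in> set ps \<and>
     length (filter (\<lambda>w. w \<noteq> v \<and> (w, v) \<notin> set ps) [0..<n]) < 3"

text \<open>The two readings of \<open>10\<close> are complementary: if \<open>xs ! i\<close> has no
  out-neighbour in \<open>P\<close>, all of \<open>P\<close> dominates it, so splitting on a pair
  with \<open>10\<close> is exhaustive. They also fit together in a cycle: an out-neighbour in
  \<open>P\<close> of one vertex automatically points to every vertex that \<open>P\<close>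
  dominates. For empty \<open>P\<close>, pairs \<open>(10, j)\<close> hold vacuously and pairs
  \<open>(i, 10)\<close> fail.\<close>

definition holds :: "('a \<Rightarrow> 'a \<Rightarrow> bool) \<Rightarrow> 'a list \<Rightarrow> 'a set \<Rightarrow> nat \<Rightarrow> nat \<Rightarrow> bool" where
  "holds E xs P i j \<longleftrightarrow>
     (if i = 10 then \<forall>p\<in>P. E p (xs ! j)
      else if j = 10 then \<exists>p\<in>P. E (xs ! i) p
      else E (xs ! i) (xs ! j))"

context tournament_graph
begin

text \<open>Induction on the certificate with \<open>ps\<close> arbitrary, since each split extends
  it. The bound \<open>length xs \<le> 10\<close> keeps the index \<open>10\<close> free for the
  block \<open>P\<close>.\<close>

lemma check_sound:
  assumes K: "K = set xs \<union> P" "K \<subseteq> V" "set xs \<inter> P = {}"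
    and xs: "distinct xs" "length xs \<le> 10"
    and deg: "\<And>v. v \<in> K \<Longrightarrow> 3 \<le> card {w \<in> K. E v w}"
    and "check (length xs) ps t" "\<forall>(i, j)\<in>set ps. holds E xs P i j"
  shows "disjoint_cycles_4_5 K E"
  using assms(7,8)
proof (induction t arbitrary: ps)
  case (Sp i j s t)
  have in_V: "xs ! k \<in> V" if "k < length xs" for k
    using that K by auto
  have "holds E xs P i j \<or> holds E xs P j i"
  proof (cases "i = 10 \<or> j = 10")
    case True
    \<comment> \<open>As \<open>i\<close> and \<open>j\<close> differ and are list positions or
      \<open>10\<close>, exactly one of them is \<open>10\<close>.\<close>
    then obtain k where "k < length xs" "(i = 10 \<and> j = k) \<or> (i = k \<and> j = 10)"
      using Sp.prems(1) by auto
    moreover from this have "E p (xs ! k) \<or> E (xs ! k) p" if "p \<in> P" for p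
      using that K(1,2,3) in_V nth_mem arc_total by (metis IntI UnI2 emptyE subsetD)
    ultimately show ?thesis
      using xs(2) by (auto simp: holds_def)
  next
    case False
    then have "i < length xs" "j < length xs" "xs ! i \<noteq> xs ! j"
      using Sp.prems(1) xs(1) by (auto simp: nth_eq_iff_index_eq)
    then show ?thesis
      using False in_V arc_total by (auto simp: holds_def)
  qed
  then show ?case
    using Sp by auto
next
  case (Cy a b c d e f g h i)
  let ?n = "length xs"
  have lt: "a < ?n" "b < ?n" "c < ?n" "e < ?n" "f < ?n" "g < ?n" "h < ?n"
    and di: "d < ?n \<or> d = 10" "i < ?n \<or> i = 10"
    and dist: "distinct [a, b, c, d, e, f, g, h, i]"
    using Cy.prems(1) by simp_all
  have arcs: "holds E xs P a b" "holds E xs P b c" "holds E xs P c d" "holds E xs P d a"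
    "holds E xs P e f" "holds E xs P f g" "holds E xs P g h" "holds E xs P h i" "holds E xs P i e"
    using Cy.prems by auto
  have ne10: "k \<noteq> 10" if "k < ?n" for k
    using that xs(2) by simp
  \<comment> \<open>Realises a possibly symbolic last position \<open>l\<close> by an actual vertex
    between \<open>xs ! k\<close> and \<open>xs ! m\<close>.\<close>
  have ex_vertex: "\<exists>y\<in>K. E (xs ! k) y \<and> E y (xs ! m) \<and> (if l = 10 then y \<in> P else y = xs ! l)"
    if "holds E xs P k l" "holds E xs P l m" "k < ?n" "m < ?n" "l < ?n \<or> l = 10" for k l m
    using that ne10 K(1) by (auto simp: holds_def split: if_splits)
  obtain y z where y: "y \<in> K" "E (xs ! c) y" "E y (xs ! a)" "if d = 10 then y \<in> P else y = xs ! d"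
    and z: "z \<in> K" "E (xs ! h) z" "E z (xs ! e)" "if i = 10 then z \<in> P else z = xs ! i"
    using ex_vertex[OF arcs(3,4) lt(3,1) di(1)] ex_vertex[OF arcs(8,9) lt(7,4) di(2)] by blast
  have not_P: "xs ! k \<notin> P" if "k < ?n" for k
    using that K(3) nth_mem by blast
  have new: "y \<noteq> xs ! k" if "k < ?n" "k \<noteq> d" for k
    using y(4) that not_P[OF that(1)] di(1) xs(1)
    by (auto simp: nth_eq_iff_index_eq split: if_splits)
  have new': "z \<noteq> xs ! k" if "k < ?n" "k \<noteq> i" for k
    using z(4) that not_P[OF that(1)] di(2) xs(1)
    by (auto simp: nth_eq_iff_index_eq split: if_splits)
  have "y \<noteq> z"
  proof (cases "i = 10")
    case True
    then have "z \<in> P" "d < ?n"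
      using z(4) di(1) dist by auto
    then show ?thesis
      using y(4) ne10 not_P by auto
  next
    case False
    then show ?thesis
      using z(4) new[of i] di(2) dist by auto
  qed
  have mem: "xs ! k \<in> K" if "k < ?n" for k
    using that K(1) by simp
  have old: "xs ! k = xs ! l \<longleftrightarrow> k = l" if "k < ?n" "l < ?n" for k l
    using that xs(1) by (simp add: nth_eq_iff_index_eq)
  have "is_cycle K E [xs ! a, xs ! b, xs ! c, y]"
    unfolding is_cycle_4 using arcs lt ne10 y new[symmetric] mem old dist by (simp add: holds_def)
  moreover have "is_cycle K E [xs ! e, xs ! f, xs ! g, xs ! h, z]"
    unfolding is_cycle_5 using arcs lt ne10 z new'[symmetric] mem old dist by (simp add: holds_def)
  moreover have "set [xs ! a, xs ! b, xs ! c, y] \<inter> set [xs ! e, xs ! f, xs ! g, xs ! h, z] = {}"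
    using lt \<open>y \<noteq> z\<close> new[of e] new[of f] new[of g] new[of h] new'[of a] new'[of b] new'[of c]
      old dist by auto
  ultimately show ?case
    unfolding disjoint_cycles_4_5_def
    by (intro exI[of _ "[xs ! a, xs ! b, xs ! c, y]"]
        exI[of _ "[xs ! e, xs ! f, xs ! g, xs ! h, z]"]) simp
next
  case (Dg v)
  let ?ws = "filter (\<lambda>w. w \<noteq> v \<and> (w, v) \<notin> set ps) [0..<length xs]"
  have v: "v < length xs" "holds E xs P 10 v"
    using Dg.prems by auto
  \<comment> \<open>All of \<open>P\<close> dominates \<open>xs ! v\<close>, so its out-neighbours
    are list vertices, and none of them is known to point to it.\<close>
  have "{w \<in> K. E (xs ! v) w} \<subseteq> (!) xs ` set ?ws"
  proof
    fix w assume w: "w \<in> {w \<in> K. E (xs ! v) w}"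
    then have "w \<notin> P"
      using v(2) arc_asym by (auto simp: holds_def)
    then obtain k where k: "k < length xs" "w = xs ! k"
      using w K(1) by (auto simp: in_set_conv_nth)
    then have "k \<noteq> v" "\<not> holds E xs P k v"
      using w v(1) xs(2) arc_irrefl arc_asym by (auto simp: holds_def)
    then show "w \<in> (!) xs ` set ?ws"
      using k Dg.prems(2) by auto
  qed
  then have "card {w \<in> K. E (xs ! v) w} \<le> card ((!) xs ` set ?ws)"
    by (rule card_mono[rotated]) simp
  also have "\<dots> \<le> length ?ws"
    by (rule le_trans[OF card_image_le[OF finite_set] card_length])
  also have "\<dots> < 3"
    using Dg.prems(1) by simp
  finally show ?case
    using deg[of "xs ! v"] v(1) K(1) by simp
qed

end

text \<open>
  In all configurations the positions \<open>0, \<dots>, 4\<close> form the 5-cycle \<open>S\<close>, followed by the vertices of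
  the last components of \<open>X\<close> (preceded, in the first two configurations, by a vertex \<open>5\<close> of the
  remaining part of \<open>X\<close>), and position \<open>0\<close> is an in-neighbour of the remaining part, or of the
  triangle if nothing remains. The certificates were found by computer search.
\<close>

definition arcs_points :: "(nat \<times> nat) list" where
  "arcs_points =
    [(0, 1), (1, 2), (2, 3), (3, 4), (4, 0), (5, 6), (5, 7), (5, 8), (6, 7), (6, 8), (7, 8), (0,
     5), (10, 6), (10, 7), (10, 8)]"

definition arcs_triangle :: "(nat \<times> nat) list" where
  "arcs_triangle =
    [(0, 1), (1, 2), (2, 3), (3, 4), (4, 0), (5, 6), (5, 7), (5, 8), (6, 7), (7, 8), (8, 6), (0,
     5), (10, 6), (10, 7), (10, 8)]"

definition arcs_triangle_point :: "(nat \<times> nat) list" where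
  "arcs_triangle_point =
    [(0, 1), (1, 2), (2, 3), (3, 4), (4, 0), (5, 6), (6, 7), (7, 5), (5, 8), (6, 8), (7, 8),
     (10, 5), (10, 6), (10, 7), (10, 8), (0, 10)]"

text \<open>Here \<open>P\<close> is empty. The vacuous pairs \<open>(10, k)\<close> are listed so
  that \<open>Dg\<close> can be applied at every vertex.\<close>

definition arcs_triangle_point_only :: "(nat \<times> nat) list" where
  "arcs_triangle_point_only =
    [(0, 1), (1, 2), (2, 3), (3, 4), (4, 0), (5, 6), (6, 7), (7, 5), (5, 8), (6, 8), (7, 8), (0,
     5), (10, 0), (10, 1), (10, 2), (10, 3), (10, 4), (10, 5), (10, 6), (10, 7), (10, 8)]"

definition arcs_triangle_points :: "(nat \<times> nat) list" where
  "arcs_triangle_points =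
    [(0, 1), (1, 2), (2, 3), (3, 4), (4, 0), (5, 6), (6, 7), (7, 5), (5, 8), (6, 8), (7, 8), (5,
     9), (6, 9), (7, 9), (8, 9), (10, 5), (10, 6), (10, 7), (10, 8), (10, 9), (0, 10)]"

definition arcs_triangle_points_only :: "(nat \<times> nat) list" where
  "arcs_triangle_points_only =
    [(0, 1), (1, 2), (2, 3), (3, 4), (4, 0), (5, 6), (6, 7), (7, 5), (5, 8), (6, 8), (7, 8), (5,
     9), (6, 9), (7, 9), (8, 9), (0, 5), (10, 0), (10, 1), (10, 2), (10, 3), (10, 4), (10, 5),
     (10, 6), (10, 7), (10, 8), (10, 9)]"

definition cert_points :: cert where
  "cert_points =
    Sp 0 8 (Sp 8 1 (Sp 1 10 (Sp 3 5 (Sp 3 6 (Sp 4 7 (Sp 3 7 (Sp 2 4 (Sp 2 7 (Sp 3 8 (Sp 8 2 (Sp 0 7 (Dg 7) (Cy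
    2 3 5 8 6 7 0 1 10)) (Dg 8)) (Cy 0 1 2 4 3 5 6 7 8)) (Cy 6 8 1 10 2 4 0 5 7)) (Sp 4 5 (Sp 2 7 (Sp 7 0 (Sp
    4 8 (Cy 0 5 6 7 1 2 3 4 8) (Cy 7 0 1 10 4 2 3 6 8)) (Dg 7)) (Cy 6 8 1 10 2 3 4 5 7)) (Cy 4 2 3 5 6 7 8 1
    10))) (Cy 6 8 1 10 3 4 0 5 7)) (Cy 4 0 5 7 1 2 3 6 8)) (Cy 7 8 1 10 3 4 0 5 6)) (Cy 3 4 0 5 6 7 8 1 10))
    (Sp 7 3 (Sp 10 2 (Sp 6 2 (Sp 2 8 (Sp 8 3 (Sp 6 1 (Sp 8 4 (Sp 10 3 (Sp 6 3 (Sp 7 2 (Sp 7 1 (Sp 5 3 (Sp 3 0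
    (Sp 7 4 (Sp 3 1 (Cy 3 1 2 8 4 0 5 6 7) (Dg 3)) (Cy 3 0 5 6 4 7 1 2 8)) (Dg 3)) (Cy 3 5 6 7 4 0 1 2 8)) (Cy
    1 7 2 8 3 4 0 5 6)) (Cy 1 2 7 8 3 4 0 5 6)) (Cy 1 2 3 6 4 0 5 7 8)) (Cy 6 7 3 10 4 0 1 2 8)) (Dg 8)) (Cy 1
    6 2 8 3 4 0 5 7)) (Dg 8)) (Sp 2 5 (Sp 6 0 (Sp 3 1 (Sp 7 1 (Sp 5 1 (Sp 1 4 (Sp 3 8 (Sp 7 4 (Cy 1 2 3 8 4 0
    5 6 7) (Cy 3 1 4 7 2 5 6 0 8)) (Cy 3 4 0 8 1 2 5 6 7)) (Dg 1)) (Cy 1 5 6 7 2 3 4 0 8)) (Cy 2 5 6 8 3 4 0 1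
    7)) (Cy 0 1 3 4 2 5 6 7 8)) (Cy 1 2 5 8 3 4 0 6 7)) (Sp 6 1 (Sp 10 3 (Sp 8 3 (Sp 2 0 (Sp 10 4 (Sp 5 4 (Sp
    7 4 (Sp 6 4 (Sp 6 3 (Sp 7 2 (Sp 2 4 (Sp 5 3 (Sp 3 0 (Sp 8 4 (Dg 4) (Cy 1 2 4 8 3 0 5 6 7)) (Dg 3)) (Cy 0 1
    2 4 3 5 6 7 8)) (Dg 2)) (Cy 1 2 7 8 3 4 0 5 6)) (Cy 4 0 5 7 1 2 3 6 8)) (Cy 3 4 6 7 1 2 0 5 8)) (Cy 3 4 7
    8 1 2 0 5 6)) (Cy 1 2 0 8 3 4 5 6 7)) (Cy 2 0 5 6 7 8 3 4 10)) (Sp 2 4 (Sp 2 7 (Sp 5 1 (Sp 3 6 (Cy 3 6 7 8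
    1 2 4 0 5) (Cy 1 2 7 8 3 4 0 5 6)) (Cy 0 2 3 4 1 5 6 7 8)) (Dg 2)) (Dg 2))) (Sp 8 4 (Sp 6 3 (Sp 7 2 (Sp 4
    7 (Sp 0 2 (Dg 2) (Cy 4 7 3 8 1 2 0 5 6)) (Cy 1 2 3 8 4 0 5 6 7)) (Cy 1 2 7 8 3 4 0 5 6)) (Cy 1 2 3 6 4 0 5
    7 8)) (Dg 8))) (Sp 4 2 (Sp 0 2 (Dg 2) (Cy 6 7 3 10 1 2 0 5 8)) (Cy 6 7 3 10 1 2 4 0 8))) (Cy 1 6 7 8 2 3 4
    0 5)))) (Cy 1 2 6 8 3 4 0 5 7)) (Cy 8 1 2 10 3 4 0 5 7)) (Sp 4 6 (Sp 1 7 (Sp 7 4 (Sp 8 3 (Sp 6 3 (Sp 7 2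
    (Sp 0 2 (Sp 10 2 (Sp 8 2 (Sp 5 3 (Sp 6 2 (Sp 2 5 (Sp 3 1 (Sp 0 3 (Cy 2 5 6 8 4 0 3 1 7) (Cy 3 0 2 5 1 7 4
    6 8)) (Cy 2 5 6 8 4 0 1 3 7)) (Dg 2)) (Cy 1 2 6 8 4 0 5 3 7)) (Cy 4 0 1 7 2 3 5 6 8)) (Cy 1 7 2 8 3 4 0 5
    6)) (Cy 6 7 2 10 3 4 0 5 8)) (Cy 4 6 3 7 1 2 0 5 8)) (Cy 1 2 7 8 3 4 0 5 6)) (Cy 4 0 5 7 1 2 3 6 8)) (Cy 1
    2 3 8 4 0 5 6 7)) (Sp 7 0 (Sp 7 2 (Sp 2 6 (Sp 3 5 (Sp 8 4 (Sp 6 1 (Cy 4 7 0 8 1 2 3 5 6) (Cy 2 3 5 7 4 0 1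
    6 8)) (Cy 0 5 6 7 1 2 3 4 8)) (Cy 1 2 6 8 0 5 3 4 7)) (Cy 2 3 4 6 1 7 0 5 8)) (Dg 7)) (Dg 7))) (Sp 4 8 (Sp
    8 2 (Sp 8 3 (Sp 10 2 (Sp 5 1 (Sp 6 2 (Sp 5 2 (Sp 0 2 (Sp 6 1 (Sp 1 3 (Sp 4 2 (Dg 2) (Cy 1 3 7 8 2 4 0 5
    6)) (Dg 1)) (Cy 1 6 7 8 2 3 4 0 5)) (Cy 1 2 0 5 3 4 6 7 8)) (Cy 3 4 0 8 1 2 5 6 7)) (Cy 1 2 6 7 3 4 0 5
    8)) (Cy 1 5 6 7 2 3 4 0 8)) (Cy 7 1 2 10 3 4 0 5 8)) (Dg 8)) (Dg 8)) (Cy 1 2 3 7 4 0 5 6 8))) (Cy 4 0 5 6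
    1 2 3 7 8)))) (Sp 8 4 (Sp 8 3 (Sp 8 2 (Sp 3 10 (Sp 4 2 (Sp 1 7 (Sp 2 7 (Sp 0 7 (Sp 7 4 (Cy 4 0 1 7 6 8 2 3
    10) (Dg 7)) (Cy 0 5 6 7 8 4 2 3 10)) (Cy 4 0 1 8 6 7 2 3 10)) (Cy 4 0 5 8 7 1 2 3 10)) (Cy 0 1 2 4 6 7 8 3
    10)) (Sp 7 1 (Sp 5 2 (Sp 10 2 (Sp 6 3 (Sp 6 2 (Sp 7 2 (Sp 7 3 (Sp 5 3 (Sp 2 0 (Sp 7 4 (Sp 3 1 (Cy 2 3 1 8
    4 0 5 6 7) (Dg 3)) (Cy 2 0 5 6 3 4 7 1 8)) (Dg 2)) (Cy 4 0 1 8 2 3 5 6 7)) (Cy 1 2 3 7 4 0 5 6 8)) (Cy 2 7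
    1 8 3 4 0 5 6)) (Cy 1 2 6 7 3 4 0 5 8)) (Cy 4 0 5 8 1 2 3 6 7)) (Cy 3 4 0 8 6 7 1 2 10)) (Cy 3 4 0 8 1 2 5
    6 7)) (Sp 10 2 (Sp 3 1 (Sp 2 7 (Sp 4 7 (Sp 7 3 (Cy 3 1 2 7 4 0 5 6 8) (Dg 7)) (Cy 2 3 1 8 4 0 5 6 7)) (Cy
    2 3 1 7 4 0 5 6 8)) (Sp 5 2 (Sp 3 5 (Sp 2 7 (Sp 4 7 (Sp 7 3 (Sp 2 6 (Cy 4 0 1 8 3 5 2 6 7) (Cy 4 0 1 8 3 5
    6 2 7)) (Dg 7)) (Cy 4 0 1 7 2 3 5 6 8)) (Cy 4 0 1 8 2 3 5 6 7)) (Sp 10 4 (Sp 5 4 (Sp 6 1 (Sp 6 3 (Sp 3 7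
    (Sp 6 2 (Sp 4 1 (Sp 0 3 (Dg 3) (Cy 4 1 7 8 2 3 0 5 6)) (Cy 2 3 7 8 1 4 0 5 6)) (Cy 3 4 0 5 2 6 1 7 8)) (Dg
    3)) (Cy 1 2 3 6 4 0 5 7 8)) (Sp 6 2 (Sp 4 1 (Sp 0 7 (Sp 0 3 (Sp 0 2 (Sp 3 7 (Sp 7 2 (Dg 2) (Dg 7)) (Dg 3))
    (Cy 2 0 5 6 3 4 1 7 8)) (Cy 2 3 0 5 4 1 6 7 8)) (Cy 0 5 6 7 2 3 4 1 8)) (Sp 2 7 (Sp 7 4 (Sp 4 6 (Sp 4 2
    (Sp 2 0 (Sp 5 1 (Cy 1 2 0 5 3 4 6 7 8) (Cy 2 0 1 5 3 4 6 7 8)) (Dg 2)) (Dg 4)) (Dg 4)) (Sp 7 0 (Sp 7 3 (Sp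
    3 6 (Sp 5 1 (Cy 2 3 6 8 0 5 1 4 7) (Cy 4 0 1 5 3 6 2 7 8)) (Dg 3)) (Dg 7)) (Dg 7))) (Sp 2 4 (Sp 4 6 (Sp 2
    0 (Sp 5 1 (Cy 3 4 6 8 2 0 5 1 7) (Cy 3 4 6 8 2 0 1 5 7)) (Dg 2)) (Dg 4)) (Dg 2)))) (Sp 5 1 (Cy 2 6 7 8 1 3
    4 0 5) (Cy 2 6 7 8 3 4 0 1 5)))) (Sp 0 3 (Sp 3 6 (Sp 3 7 (Sp 0 7 (Sp 7 4 (Sp 1 5 (Cy 2 3 6 8 4 0 1 5 7)
    (Cy 2 3 6 8 4 0 5 1 7)) (Dg 7)) (Cy 4 5 6 8 0 1 2 3 7)) (Dg 3)) (Dg 3)) (Cy 0 1 2 3 4 5 6 7 8))) (Sp 0 3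
    (Sp 3 6 (Sp 0 7 (Sp 3 7 (Sp 7 2 (Sp 5 1 (Cy 2 3 6 7 4 0 5 1 8) (Cy 2 3 6 7 4 0 1 5 8)) (Dg 7)) (Dg 3)) (Cy
    0 5 6 7 8 2 3 4 10)) (Dg 3)) (Cy 2 3 0 5 6 7 8 4 10)))) (Cy 0 1 3 4 2 5 6 7 8))) (Sp 3 7 (Sp 2 7 (Sp 3 1
    (Sp 7 4 (Cy 2 3 1 8 4 0 5 6 7) (Dg 7)) (Cy 0 1 3 4 6 7 8 2 10)) (Cy 6 7 2 10 3 4 0 5 8)) (Cy 6 8 2 10 3 4
    0 1 7))))) (Dg 8)) (Dg 8)) (Dg 8))) (Sp 1 4 (Sp 10 4 (Sp 3 10 (Sp 1 6 (Sp 1 7 (Sp 8 1 (Sp 4 6 (Sp 0 7 (Sp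
    3 7 (Sp 7 2 (Cy 7 2 3 10 0 1 4 6 8) (Dg 7)) (Cy 6 7 3 10 1 4 0 5 8)) (Cy 0 5 6 7 8 1 2 3 10)) (Cy 4 0 5 6
    8 1 2 3 10)) (Sp 7 2 (Sp 8 4 (Cy 7 2 3 10 4 0 1 6 8) (Cy 0 1 4 8 6 7 2 3 10)) (Sp 5 1 (Sp 2 8 (Sp 3 8 (Dg
    8) (Cy 1 4 0 5 6 7 8 3 10)) (Cy 1 4 0 5 6 8 2 3 10)) (Sp 5 2 (Sp 5 4 (Sp 3 8 (Sp 2 8 (Dg 8) (Cy 4 0 1 5 6
    8 2 3 10)) (Cy 4 0 1 5 6 7 8 3 10)) (Cy 2 3 4 5 0 1 6 7 8)) (Sp 3 7 (Sp 7 0 (Sp 7 4 (Sp 2 8 (Sp 8 3 (Cy 6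
    8 3 10 0 1 2 5 7) (Dg 8)) (Cy 8 2 3 10 4 0 1 6 7)) (Dg 7)) (Dg 7)) (Cy 6 7 3 10 0 1 2 5 8)))))) (Cy 0 5 6
    8 7 1 2 3 10)) (Cy 0 5 7 8 6 1 2 3 10)) (Sp 4 7 (Sp 1 7 (Sp 3 7 (Sp 7 2 (Sp 5 1 (Sp 6 1 (Sp 6 4 (Sp 1 8
    (Cy 2 3 4 7 0 5 6 1 8) (Cy 4 0 5 6 1 2 3 7 8)) (Cy 0 5 7 8 1 2 3 4 6)) (Cy 2 3 4 7 0 5 1 6 8)) (Cy 2 3 4 7
    0 1 5 6 8)) (Dg 7)) (Sp 1 3 (Sp 0 7 (Sp 7 2 (Sp 5 1 (Sp 6 1 (Sp 6 4 (Sp 8 1 (Sp 6 3 (Sp 6 2 (Sp 5 3 (Sp 8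
    3 (Dg 3) (Cy 4 0 5 6 1 7 2 3 8)) (Cy 2 3 5 6 1 4 0 7 8)) (Cy 1 2 6 8 3 4 0 5 7)) (Cy 2 3 6 7 1 4 0 5 8))
    (Cy 2 3 4 7 0 5 6 1 8)) (Cy 0 5 7 8 1 2 3 4 6)) (Cy 2 3 4 7 0 5 1 6 8)) (Cy 2 3 4 7 0 1 5 6 8)) (Dg 7))
    (Sp 4 8 (Sp 1 8 (Sp 8 3 (Sp 8 2 (Sp 5 3 (Sp 3 6 (Sp 1 6 (Sp 5 4 (Sp 1 5 (Cy 2 3 6 8 0 1 5 4 7) (Cy 2 3 4 8
    0 5 1 6 7)) (Cy 2 3 6 8 0 1 4 5 7)) (Cy 2 3 4 8 0 5 6 1 7)) (Dg 3)) (Cy 0 1 4 7 2 3 5 6 8)) (Dg 8)) (Dg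
    8)) (Cy 0 5 6 7 1 2 3 4 8)) (Sp 5 2 (Sp 2 7 (Sp 5 3 (Sp 1 6 (Sp 1 8 (Sp 5 4 (Sp 4 6 (Sp 0 3 (Sp 3 8 (Sp 8
    2 (Sp 5 1 (Cy 0 5 1 7 2 3 4 6 8) (Cy 0 1 5 7 2 3 4 6 8)) (Dg 8)) (Dg 3)) (Sp 5 1 (Cy 4 6 7 8 1 2 3 0 5)
    (Cy 4 6 7 8 2 3 0 1 5))) (Sp 4 2 (Sp 1 5 (Cy 3 4 2 7 0 1 5 6 8) (Cy 3 4 2 7 0 5 1 6 8)) (Dg 4))) (Cy 0 1 6
    8 3 4 5 2 7)) (Cy 1 6 7 8 2 3 4 0 5)) (Sp 6 4 (Sp 6 3 (Sp 5 4 (Sp 3 0 (Sp 2 4 (Dg 4) (Cy 4 2 7 8 1 3 0 5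
    6)) (Dg 3)) (Cy 3 4 5 6 0 1 2 7 8)) (Cy 1 2 3 6 4 0 5 7 8)) (Cy 1 3 4 6 0 5 2 7 8))) (Sp 2 8 (Cy 3 5 6 7 4
    0 1 2 8) (Cy 0 1 4 7 2 3 5 6 8))) (Sp 5 1 (Sp 6 1 (Sp 8 1 (Sp 6 3 (Sp 6 4 (Sp 6 2 (Sp 8 3 (Sp 3 0 (Cy 1 4
    7 8 2 3 0 5 6) (Dg 3)) (Cy 1 2 3 8 0 5 6 4 7)) (Cy 1 2 6 8 3 4 0 5 7)) (Cy 0 5 7 8 1 2 3 4 6)) (Cy 2 3 6 7
    1 4 0 5 8)) (Cy 2 3 4 7 0 5 6 1 8)) (Cy 2 3 4 7 0 5 1 6 8)) (Cy 2 3 4 7 0 1 5 6 8))) (Sp 2 8 (Sp 6 4 (Sp 5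
    4 (Sp 6 3 (Sp 2 4 (Dg 4) (Cy 0 1 7 8 3 4 2 5 6)) (Cy 3 6 4 7 0 1 2 5 8)) (Cy 0 1 2 8 3 4 5 6 7)) (Cy 3 4 6
    7 0 1 2 5 8)) (Cy 0 1 3 4 2 5 6 7 8))))) (Sp 4 2 (Cy 2 3 1 4 0 5 6 7 8) (Cy 0 5 6 8 3 1 2 4 7)))) (Cy 0 5
    6 8 1 2 3 4 7)) (Sp 8 3 (Sp 5 3 (Sp 3 1 (Sp 8 2 (Sp 10 1 (Sp 2 4 (Sp 8 1 (Sp 6 2 (Sp 6 4 (Sp 6 1 (Sp 4 8
    (Sp 7 1 (Sp 0 7 (Sp 5 1 (Dg 1) (Cy 0 7 4 8 2 3 1 5 6)) (Cy 0 5 6 7 2 3 1 4 8)) (Cy 4 0 5 6 2 3 1 7 8)) (Dg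
    4)) (Cy 4 0 5 7 2 3 1 6 8)) (Cy 0 5 7 8 2 3 1 4 6)) (Cy 3 4 0 5 1 2 6 7 8)) (Cy 2 3 1 8 4 0 5 6 7)) (Cy 2
    3 1 4 0 5 6 7 8)) (Cy 4 0 5 7 8 2 3 1 10)) (Cy 3 1 2 8 4 0 5 6 7)) (Sp 1 8 (Sp 6 3 (Sp 3 0 (Sp 3 7 (Sp 2 8
    (Sp 5 4 (Sp 8 4 (Sp 4 2 (Sp 4 6 (Sp 5 1 (Cy 4 6 7 8 1 2 3 0 5) (Cy 4 2 3 7 0 1 5 6 8)) (Dg 4)) (Dg 4)) (Dg
    8)) (Cy 0 1 2 8 4 5 6 3 7)) (Sp 1 6 (Sp 5 4 (Sp 4 2 (Sp 5 1 (Cy 4 2 3 7 0 5 1 6 8) (Cy 4 2 3 7 0 1 5 6 8))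
    (Sp 4 6 (Sp 1 5 (Cy 3 0 1 5 2 4 6 7 8) (Cy 1 3 0 5 2 4 6 7 8)) (Dg 4))) (Cy 4 5 6 7 2 3 0 1 8)) (Cy 2 3 7
    8 1 4 0 5 6))) (Dg 3)) (Dg 3)) (Sp 2 5 (Sp 4 5 (Sp 8 2 (Cy 0 1 3 4 2 5 6 7 8) (Cy 0 1 2 8 4 5 3 6 7)) (Cy
    3 6 7 8 4 0 1 2 5)) (Sp 2 4 (Sp 1 5 (Cy 3 6 7 8 2 4 0 1 5) (Cy 3 6 7 8 1 2 4 0 5)) (Sp 5 1 (Cy 0 5 1 8 4 2
    3 6 7) (Cy 0 1 5 8 4 2 3 6 7))))) (Sp 6 3 (Sp 3 0 (Sp 3 7 (Sp 4 6 (Sp 0 2 (Sp 2 5 (Cy 3 0 2 5 1 4 6 7 8)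
    (Cy 2 3 0 5 1 4 6 7 8)) (Cy 4 6 3 7 1 2 0 5 8)) (Cy 4 0 5 6 1 2 3 7 8)) (Dg 3)) (Dg 3)) (Cy 4 0 5 7 1 2 3
    6 8)))) (Sp 4 2 (Sp 7 2 (Sp 6 1 (Sp 6 4 (Sp 0 2 (Sp 10 2 (Sp 1 3 (Sp 6 2 (Sp 2 8 (Sp 8 4 (Sp 1 7 (Cy 0 1 7
    8 4 2 3 5 6) (Cy 4 0 2 8 1 3 5 6 7)) (Cy 0 1 4 8 2 3 5 6 7)) (Dg 2)) (Cy 3 5 7 8 1 4 0 2 6)) (Cy 2 3 1 4 0
    5 6 7 8)) (Cy 6 1 2 10 3 4 0 5 8)) (Cy 2 0 1 4 3 5 6 7 8)) (Cy 0 5 7 8 1 2 3 4 6)) (Cy 0 1 6 8 4 2 3 5 7))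
    (Cy 3 5 6 8 4 0 1 2 7)) (Cy 0 1 2 4 3 5 6 7 8))) (Sp 1 8 (Sp 5 4 (Sp 8 2 (Sp 1 3 (Sp 8 4 (Sp 4 6 (Sp 4 2
    (Sp 5 2 (Sp 1 7 (Sp 5 1 (Sp 2 6 (Cy 4 2 6 7 0 5 1 3 8) (Cy 2 3 4 6 0 5 1 7 8)) (Sp 6 3 (Sp 6 2 (Cy 2 3 4 6
    0 1 5 7 8) (Cy 3 4 2 6 0 1 5 7 8)) (Cy 2 3 6 8 4 0 1 5 7))) (Cy 1 4 6 7 0 5 2 3 8)) (Cy 0 1 3 4 2 5 6 7
    8)) (Dg 4)) (Dg 4)) (Dg 8)) (Cy 2 3 1 8 4 0 5 6 7)) (Dg 8)) (Cy 4 5 6 7 0 1 2 3 8)) (Cy 1 2 3 8 4 0 5 6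
    7))))) (Sp 2 7 (Sp 2 6 (Sp 3 7 (Sp 0 7 (Sp 7 1 (Sp 2 4 (Cy 0 5 6 8 7 1 2 4 10) (Cy 0 5 6 8 1 4 2 3 7)) (Dg
    7)) (Sp 3 8 (Sp 2 8 (Sp 4 8 (Dg 8) (Cy 6 8 4 10 0 1 2 3 7)) (Cy 0 5 6 7 8 2 3 4 10)) (Cy 0 1 2 7 6 8 3 4
    10))) (Cy 7 3 4 10 0 1 2 6 8)) (Cy 0 5 7 8 6 2 3 4 10)) (Cy 0 5 6 8 7 2 3 4 10))) (Cy 1 2 3 4 0 5 6 7 8))"

definition cert_triangle :: cert where
  "cert_triangle =
    Sp 4 1 (Sp 0 7 (Sp 0 8 (Sp 0 6 (Sp 7 1 (Sp 8 4 (Sp 6 3 (Sp 5 2 (Sp 10 1 (Sp 8 1 (Sp 7 2 (Sp 6 1 (Sp 5 1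
    (Dg 1) (Cy 6 1 5 8 2 3 4 0 7)) (Cy 1 6 7 8 2 3 4 0 5)) (Cy 1 2 7 8 3 4 0 5 6)) (Cy 6 7 1 8 2 3 4 0 5)) (Cy
    6 7 1 10 2 3 4 0 5)) (Cy 1 2 5 7 6 3 4 0 8)) (Cy 4 0 5 8 1 2 3 6 7)) (Sp 10 1 (Sp 6 2 (Sp 1 3 (Sp 5 2 (Sp
    8 1 (Sp 5 1 (Sp 1 6 (Cy 1 6 7 8 2 3 4 0 5) (Dg 1)) (Cy 1 5 7 8 2 3 4 0 6)) (Cy 6 7 1 8 2 3 4 0 5)) (Cy 0 1
    3 4 6 2 5 7 8)) (Sp 2 5 (Sp 3 8 (Sp 8 1 (Sp 1 5 (Cy 1 5 7 8 2 3 4 0 6) (Dg 1)) (Dg 8)) (Cy 3 4 0 8 1 2 5 6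
    7)) (Sp 8 1 (Sp 6 1 (Dg 1) (Cy 1 6 7 8 2 3 4 0 5)) (Cy 6 7 1 8 2 3 4 0 5)))) (Sp 3 8 (Sp 8 1 (Sp 3 5 (Sp 4
    6 (Sp 6 1 (Sp 6 3 (Sp 1 3 (Sp 7 2 (Sp 0 2 (Sp 1 5 (Cy 0 2 3 4 6 1 5 7 8) (Dg 1)) (Cy 2 0 5 7 6 1 3 4 8))
    (Cy 1 2 7 8 3 4 0 5 6)) (Dg 1)) (Dg 6)) (Dg 6)) (Cy 6 4 0 8 1 2 3 5 7)) (Cy 3 4 0 5 1 2 6 7 8)) (Dg 8))
    (Cy 1 2 6 7 3 4 0 5 8))) (Sp 3 8 (Sp 8 2 (Cy 6 7 1 10 2 3 4 0 8) (Dg 8)) (Cy 6 7 1 10 3 4 0 5 8)))) (Sp 1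
    6 (Sp 8 1 (Sp 2 5 (Sp 3 7 (Sp 7 4 (Sp 7 2 (Sp 5 3 (Sp 3 6 (Sp 6 4 (Cy 2 5 3 7 1 6 4 0 8) (Dg 6)) (Cy 1 2 5
    8 4 0 6 3 7)) (Cy 4 0 6 7 1 2 3 5 8)) (Dg 7)) (Dg 7)) (Cy 1 2 5 8 3 4 0 6 7)) (Cy 1 6 7 8 2 3 4 0 5)) (Sp
    2 7 (Sp 7 3 (Sp 7 4 (Sp 2 8 (Sp 8 4 (Sp 10 3 (Sp 5 3 (Sp 0 3 (Sp 8 3 (Sp 1 3 (Dg 3) (Cy 3 1 2 8 4 0 5 6
    7)) (Dg 8)) (Cy 4 1 2 8 3 0 5 6 7)) (Cy 3 5 6 7 4 0 1 2 8)) (Cy 6 7 3 10 4 0 1 2 8)) (Dg 8)) (Sp 5 3 (Sp 0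
    3 (Sp 10 3 (Sp 1 3 (Sp 3 8 (Sp 3 6 (Sp 6 2 (Sp 1 5 (Cy 6 2 7 8 3 4 0 1 5) (Cy 6 2 3 8 4 0 5 1 7)) (Dg 6))
    (Dg 3)) (Dg 3)) (Cy 2 3 1 8 4 0 5 6 7)) (Cy 8 2 3 10 4 0 5 6 7)) (Cy 4 1 6 7 2 3 0 5 8)) (Cy 2 3 5 8 4 0 1
    6 7))) (Dg 7)) (Dg 7)) (Sp 2 10 (Sp 3 1 (Sp 3 8 (Sp 4 8 (Dg 8) (Cy 4 0 5 8 2 3 1 6 7)) (Cy 6 7 2 10 3 4 0
    1 8)) (Cy 0 1 3 4 8 6 7 2 10)) (Sp 3 0 (Sp 4 6 (Sp 6 3 (Sp 4 2 (Sp 0 2 (Sp 6 2 (Sp 4 8 (Sp 8 2 (Dg 2) (Dg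
    8)) (Cy 4 1 7 8 2 3 0 5 6)) (Dg 6)) (Cy 2 0 5 7 6 3 4 1 8)) (Cy 2 4 1 7 6 3 0 5 8)) (Dg 6)) (Cy 6 4 1 8 2
    3 0 5 7)) (Sp 2 0 (Sp 3 8 (Sp 3 6 (Sp 6 2 (Sp 8 4 (Sp 5 1 (Cy 2 3 6 7 4 0 5 1 8) (Cy 2 0 3 6 4 1 5 7 8))
    (Dg 8)) (Dg 6)) (Cy 2 0 5 7 6 3 4 1 8)) (Cy 3 4 1 8 2 0 5 6 7)) (Sp 3 5 (Sp 4 6 (Sp 6 2 (Sp 6 3 (Sp 4 2
    (Sp 4 8 (Sp 2 8 (Dg 8) (Dg 2)) (Cy 2 3 5 6 4 0 1 7 8)) (Cy 0 1 2 4 6 3 5 7 8)) (Dg 6)) (Dg 6)) (Cy 2 3 5 7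
    6 4 0 1 8)) (Sp 5 1 (Sp 8 4 (Sp 10 3 (Sp 6 3 (Sp 1 3 (Sp 3 7 (Sp 8 2 (Sp 4 2 (Sp 3 8 (Sp 2 5 (Cy 4 0 3 8 2
    5 1 6 7) (Dg 2)) (Dg 3)) (Cy 6 3 7 8 1 2 4 0 5)) (Cy 6 7 2 8 1 3 4 0 5)) (Dg 3)) (Cy 4 0 5 8 2 3 1 6 7))
    (Cy 2 3 6 7 4 0 5 1 8)) (Cy 4 0 5 8 6 7 2 3 10)) (Sp 8 2 (Sp 8 3 (Sp 5 2 (Sp 2 6 (Sp 6 3 (Sp 3 1 (Sp 4 2
    (Dg 2) (Cy 6 3 1 8 2 4 0 5 7)) (Cy 2 6 7 8 1 3 4 0 5)) (Dg 6)) (Dg 2)) (Cy 2 5 6 7 3 4 0 1 8)) (Dg 8)) (Dg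
    8))) (Sp 8 2 (Sp 6 2 (Sp 2 5 (Sp 3 7 (Sp 3 1 (Sp 4 7 (Dg 7) (Cy 4 0 6 7 2 3 1 5 8)) (Cy 0 1 3 4 6 2 5 7
    8)) (Cy 6 2 5 8 3 4 0 1 7)) (Dg 2)) (Cy 2 6 7 8 3 4 0 1 5)) (Cy 6 7 2 8 3 4 0 1 5))))))))) (Sp 2 5 (Sp 3 8
    (Sp 3 7 (Sp 4 7 (Dg 7) (Cy 4 0 5 7 6 1 2 3 8)) (Cy 3 4 0 7 6 1 2 5 8)) (Cy 1 2 5 6 3 4 0 7 8)) (Cy 6 1 7 8
    2 3 4 0 5)))) (Cy 1 2 3 4 6 0 5 7 8)) (Cy 1 2 3 4 0 5 6 7 8)) (Cy 1 2 3 4 6 7 0 5 8)) (Sp 6 1 (Sp 10 2 (Sp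
    3 10 (Sp 3 8 (Sp 4 7 (Sp 4 8 (Sp 0 8 (Sp 8 1 (Sp 3 7 (Sp 0 7 (Sp 2 7 (Dg 7) (Cy 7 2 3 10 6 1 4 0 8)) (Cy 0
    5 6 7 1 2 3 4 8)) (Cy 6 7 3 10 1 4 0 5 8)) (Dg 8)) (Cy 0 5 7 8 6 1 2 3 10)) (Cy 4 0 5 8 6 1 2 3 10)) (Cy 4
    0 5 7 6 1 2 3 10)) (Cy 7 8 3 10 1 4 0 5 6)) (Sp 2 8 (Sp 3 7 (Sp 7 4 (Sp 3 5 (Sp 3 0 (Sp 8 3 (Sp 4 2 (Sp 1
    3 (Sp 0 2 (Sp 1 5 (Cy 0 2 3 4 6 1 5 7 8) (Cy 1 3 0 5 6 7 4 2 8)) (Cy 2 0 1 4 3 5 6 7 8)) (Cy 3 1 2 8 4 0 5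
    6 7)) (Cy 0 1 2 4 3 5 6 7 8)) (Cy 4 0 5 7 6 1 2 3 8)) (Cy 6 1 2 8 4 0 3 5 7)) (Cy 6 1 2 8 4 0 5 3 7)) (Sp
    1 7 (Sp 7 0 (Sp 3 5 (Sp 7 2 (Sp 8 0 (Sp 6 4 (Sp 8 1 (Cy 4 0 5 6 1 2 3 7 8) (Cy 2 3 5 7 6 4 0 1 8)) (Cy 0 5
    7 8 1 2 3 4 6)) (Cy 2 3 5 7 6 1 4 0 8)) (Dg 7)) (Cy 6 1 2 8 0 5 3 4 7)) (Dg 7)) (Sp 3 5 (Sp 4 6 (Sp 0 8
    (Sp 2 7 (Sp 7 0 (Sp 2 6 (Sp 4 8 (Sp 8 3 (Cy 1 2 6 7 3 4 0 5 8) (Dg 8)) (Cy 4 7 0 8 1 2 3 5 6)) (Cy 0 1 4 7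
    6 2 3 5 8)) (Dg 7)) (Cy 2 3 5 7 6 1 4 0 8)) (Cy 0 5 7 8 1 2 3 4 6)) (Cy 1 2 3 7 6 4 0 5 8)) (Cy 3 4 0 5 6
    7 1 2 8)))) (Cy 6 1 2 8 3 4 0 5 7)) (Sp 7 3 (Sp 10 1 (Sp 6 3 (Sp 7 0 (Sp 10 4 (Sp 2 6 (Sp 8 1 (Sp 8 4 (Sp
    1 3 (Sp 1 5 (Sp 3 5 (Sp 2 0 (Sp 2 4 (Cy 0 1 2 4 6 3 5 7 8) (Cy 2 0 1 4 6 3 5 7 8)) (Cy 1 5 7 8 3 4 0 2 6))
    (Cy 2 6 7 8 3 4 0 1 5)) (Cy 2 6 7 8 1 3 4 0 5)) (Cy 4 0 5 8 3 1 2 6 7)) (Cy 0 5 6 7 1 2 3 4 8)) (Cy 2 6 1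
    8 3 4 0 5 7)) (Sp 2 5 (Sp 7 1 (Sp 3 1 (Sp 8 0 (Sp 6 0 (Sp 2 4 (Sp 8 4 (Sp 7 4 (Sp 4 6 (Cy 0 5 7 8 2 3 1 4
    6) (Dg 4)) (Cy 6 0 5 8 1 2 3 4 7)) (Cy 0 5 6 7 2 3 1 4 8)) (Cy 2 3 1 4 6 0 5 7 8)) (Cy 2 5 7 8 3 1 4 0 6))
    (Cy 1 2 5 7 6 3 4 0 8)) (Cy 0 1 3 4 2 5 6 7 8)) (Cy 6 2 5 8 3 4 0 1 7)) (Sp 7 1 (Sp 8 3 (Sp 8 1 (Sp 7 2
    (Sp 2 0 (Sp 7 4 (Sp 2 4 (Sp 5 3 (Sp 3 1 (Sp 6 4 (Sp 4 8 (Cy 2 0 5 7 6 3 1 4 8) (Dg 4)) (Cy 2 0 5 8 3 1 4 6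
    7)) (Dg 3)) (Cy 0 1 2 4 6 7 3 5 8)) (Dg 2)) (Cy 3 4 7 8 1 2 0 5 6)) (Dg 2)) (Cy 1 2 7 8 3 4 0 5 6)) (Cy 6
    7 1 8 2 3 4 0 5)) (Cy 6 2 3 8 1 4 0 5 7)) (Cy 6 1 7 8 2 3 4 0 5)))) (Cy 0 5 6 7 8 2 3 4 10)) (Sp 5 2 (Sp 7
    1 (Sp 8 1 (Sp 7 2 (Sp 5 1 (Sp 1 3 (Sp 6 2 (Sp 5 3 (Sp 3 8 (Cy 1 4 0 5 6 7 2 3 8) (Dg 3)) (Cy 2 3 5 6 1 4 0
    7 8)) (Cy 2 6 7 8 1 3 4 0 5)) (Dg 1)) (Cy 6 1 5 8 2 3 4 0 7)) (Cy 1 2 7 8 3 4 0 5 6)) (Cy 6 7 1 8 2 3 4 0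
    5)) (Cy 6 1 7 8 2 3 4 0 5)) (Cy 3 4 0 7 6 1 2 5 8))) (Sp 1 5 (Sp 4 5 (Sp 4 8 (Sp 2 0 (Sp 2 5 (Sp 3 0 (Sp 6
    4 (Cy 0 1 2 3 6 4 5 7 8) (Cy 3 4 6 7 2 0 1 5 8)) (Cy 2 5 7 8 1 4 0 3 6)) (Cy 2 0 1 5 6 7 3 4 8)) (Cy 0 2 3
    4 6 1 5 7 8)) (Cy 1 2 3 6 4 0 5 7 8)) (Cy 4 0 1 5 2 3 6 7 8)) (Cy 1 4 0 5 2 3 6 7 8))) (Cy 8 6 1 10 3 4 0
    5 7)) (Cy 2 3 7 8 1 4 0 5 6)))) (Sp 3 5 (Sp 3 7 (Sp 3 8 (Sp 2 8 (Sp 4 8 (Sp 4 7 (Sp 8 0 (Sp 2 7 (Sp 8 1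
    (Sp 7 0 (Cy 0 5 6 7 1 2 3 4 8) (Dg 7)) (Dg 8)) (Cy 0 1 4 8 2 3 5 6 7)) (Dg 8)) (Cy 4 0 5 7 6 1 2 3 8)) (Cy
    6 1 2 10 4 0 5 7 8)) (Cy 7 8 2 10 1 4 0 5 6)) (Cy 6 1 2 10 3 4 0 5 8)) (Cy 6 1 2 10 3 4 0 5 7)) (Cy 3 4 0
    5 8 6 1 2 10))) (Sp 8 1 (Sp 2 5 (Sp 7 2 (Sp 6 3 (Sp 2 8 (Sp 3 5 (Sp 4 2 (Sp 8 0 (Sp 1 3 (Cy 0 1 3 4 6 7 2
    5 8) (Cy 2 3 1 4 0 5 6 7 8)) (Cy 1 4 0 8 2 3 5 6 7)) (Cy 0 1 2 4 6 3 5 7 8)) (Cy 3 4 0 5 1 6 7 2 8)) (Cy 2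
    5 7 8 3 4 0 1 6)) (Cy 2 3 6 7 1 4 0 5 8)) (Sp 3 6 (Sp 0 6 (Sp 6 4 (Sp 3 7 (Cy 4 0 5 6 1 2 3 7 8) (Cy 1 2 5
    8 3 4 0 6 7)) (Dg 6)) (Sp 3 5 (Sp 6 2 (Sp 3 1 (Sp 2 4 (Sp 3 7 (Sp 1 5 (Sp 3 0 (Sp 4 6 (Sp 3 8 (Sp 7 4 (Cy
    1 2 3 8 4 6 0 5 7) (Cy 1 4 7 8 2 3 0 5 6)) (Cy 3 5 7 8 0 1 2 4 6)) (Cy 4 0 5 6 1 2 3 7 8)) (Cy 1 5 7 8 2 4
    0 3 6)) (Cy 1 4 0 5 6 2 3 7 8)) (Cy 3 6 2 7 1 4 0 5 8)) (Cy 2 3 1 4 6 0 5 7 8)) (Cy 0 1 3 4 6 2 5 7 8))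
    (Sp 6 4 (Sp 3 0 (Sp 7 3 (Sp 5 4 (Sp 2 4 (Cy 0 1 2 4 6 7 3 5 8) (Cy 1 6 7 8 4 2 3 0 5)) (Cy 6 4 5 8 3 0 1 2
    7)) (Cy 4 0 5 6 1 2 3 7 8)) (Cy 1 2 7 8 4 0 3 5 6)) (Dg 6))) (Sp 2 6 (Cy 3 4 0 5 1 2 6 7 8) (Cy 3 4 0 5 1
    6 2 7 8)))) (Cy 1 2 7 8 3 4 0 5 6))) (Cy 1 6 7 8 2 3 4 0 5)) (Sp 7 1 (Sp 2 5 (Sp 0 8 (Sp 3 6 (Sp 3 8 (Sp 4
    8 (Dg 8) (Cy 4 0 5 8 1 2 3 6 7)) (Cy 3 4 0 8 1 2 5 6 7)) (Cy 1 2 5 7 6 3 4 0 8)) (Sp 0 2 (Sp 5 1 (Sp 3 5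
    (Sp 4 5 (Sp 6 4 (Sp 0 3 (Sp 2 7 (Sp 3 6 (Sp 4 2 (Cy 1 4 2 5 0 3 6 7 8) (Cy 1 2 4 5 0 3 6 7 8)) (Cy 0 2 7 8
    3 4 5 1 6)) (Cy 2 3 5 7 6 4 0 1 8)) (Cy 0 1 2 3 6 4 5 7 8)) (Cy 1 4 6 7 0 2 3 5 8)) (Cy 6 7 1 8 4 0 2 3
    5)) (Cy 6 7 1 8 3 4 0 2 5)) (Cy 0 2 3 4 6 7 1 5 8)) (Sp 2 8 (Sp 3 5 (Sp 2 6 (Sp 3 8 (Sp 8 4 (Sp 3 7 (Sp 4
    6 (Sp 6 3 (Cy 4 6 3 8 1 2 0 5 7) (Dg 6)) (Cy 1 2 3 7 6 4 0 5 8)) (Cy 3 5 6 7 4 0 1 2 8)) (Dg 8)) (Cy 1 2 6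
    7 3 4 0 5 8)) (Sp 8 3 (Sp 2 4 (Cy 3 5 7 8 2 4 0 1 6) (Cy 2 0 1 4 3 5 6 7 8)) (Cy 6 2 3 8 1 4 0 5 7))) (Cy
    3 4 0 5 6 7 1 2 8)) (Sp 3 1 (Sp 3 0 (Sp 4 7 (Sp 6 4 (Cy 1 6 4 7 2 3 0 5 8) (Cy 1 4 6 7 2 3 0 5 8)) (Cy 2 3
    1 8 4 0 5 6 7)) (Cy 0 3 1 4 2 5 6 7 8)) (Cy 0 1 3 4 2 5 6 7 8))))) (Cy 6 7 1 8 2 3 4 0 5)) (Sp 8 2 (Sp 10
    2 (Sp 5 3 (Sp 2 6 (Sp 5 1 (Sp 3 1 (Cy 2 6 7 8 3 1 4 0 5) (Cy 2 6 7 8 1 3 4 0 5)) (Cy 2 6 7 8 3 4 0 1 5))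
    (Sp 7 2 (Sp 6 3 (Sp 5 2 (Sp 2 4 (Sp 2 0 (Sp 5 4 (Sp 10 4 (Sp 8 4 (Sp 4 7 (Sp 1 5 (Cy 2 0 1 5 6 3 4 7 8)
    (Cy 1 2 0 5 6 3 4 7 8)) (Dg 4)) (Sp 1 5 (Cy 6 3 4 8 2 0 1 5 7) (Cy 6 3 4 8 2 0 5 1 7))) (Cy 2 0 1 7 8 6 3
    4 10)) (Cy 2 0 1 7 6 3 4 5 8)) (Dg 2)) (Dg 2)) (Cy 2 5 7 8 3 4 0 1 6)) (Sp 1 5 (Sp 4 5 (Sp 0 6 (Sp 6 4 (Sp
    0 2 (Sp 1 3 (Sp 5 2 (Dg 2) (Cy 0 1 3 4 6 2 5 7 8)) (Cy 4 0 5 6 2 3 1 7 8)) (Cy 4 5 3 6 2 0 1 7 8)) (Dg 6))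
    (Cy 6 0 1 8 2 3 4 5 7)) (Cy 4 0 1 5 2 3 6 7 8)) (Cy 1 4 0 5 2 3 6 7 8))) (Sp 1 3 (Sp 1 5 (Cy 6 2 7 8 3 4 0
    1 5) (Cy 6 2 7 8 1 3 4 0 5)) (Cy 6 2 7 8 3 1 4 0 5)))) (Sp 4 6 (Sp 4 7 (Sp 0 6 (Sp 0 7 (Sp 6 2 (Sp 7 2 (Sp
    6 3 (Sp 4 2 (Sp 5 2 (Dg 2) (Cy 2 5 7 8 3 4 0 1 6)) (Cy 0 1 2 4 6 3 5 7 8)) (Dg 6)) (Dg 7)) (Dg 6)) (Cy 2 3
    5 8 0 1 4 6 7)) (Cy 0 1 4 6 2 3 5 7 8)) (Cy 2 3 5 8 4 0 1 6 7)) (Cy 4 0 1 6 2 3 5 7 8))) (Sp 3 6 (Sp 3 5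
    (Sp 4 6 (Sp 6 0 (Cy 0 1 4 6 2 3 5 7 8) (Dg 6)) (Cy 4 0 1 6 2 3 5 7 8)) (Cy 3 4 0 5 6 7 8 2 10)) (Cy 7 8 2
    10 3 4 0 1 6))) (Sp 3 8 (Sp 8 4 (Sp 8 0 (Sp 5 4 (Sp 1 3 (Sp 7 2 (Sp 1 5 (Cy 4 0 1 5 6 7 2 3 8) (Cy 6 7 2 8
    1 3 4 0 5)) (Sp 2 5 (Sp 2 6 (Sp 3 7 (Sp 3 6 (Sp 6 4 (Sp 2 4 (Sp 4 10 (Sp 0 6 (Dg 6) (Cy 7 8 4 10 0 1 2 3
    6)) (Dg 4)) (Cy 4 2 5 6 0 1 3 7 8)) (Dg 6)) (Cy 6 3 7 8 4 0 1 2 5)) (Cy 6 7 3 8 4 0 1 2 5)) (Cy 0 1 3 4 6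
    2 5 7 8)) (Sp 3 7 (Sp 7 4 (Sp 7 0 (Sp 10 4 (Sp 4 2 (Sp 1 5 (Cy 4 2 3 8 0 1 5 6 7) (Cy 4 2 3 8 0 5 1 6 7))
    (Dg 4)) (Cy 6 7 4 10 0 5 2 3 8)) (Dg 7)) (Dg 7)) (Sp 10 4 (Sp 5 1 (Sp 2 6 (Sp 2 4 (Cy 6 7 3 8 1 2 4 0 5)
    (Cy 0 5 1 8 3 4 2 6 7)) (Cy 6 2 7 8 1 3 4 0 5)) (Sp 6 4 (Sp 2 6 (Sp 4 2 (Cy 0 1 5 8 3 4 2 6 7) (Dg 4)) (Cy
    4 0 1 5 6 2 7 3 8)) (Cy 3 4 6 7 0 1 5 2 8))) (Cy 0 1 2 8 6 7 3 4 10))))) (Sp 2 6 (Sp 3 7 (Sp 2 7 (Sp 7 4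
    (Sp 2 4 (Sp 4 10 (Cy 6 7 4 10 0 1 2 3 8) (Dg 4)) (Cy 2 3 1 4 0 5 6 7 8)) (Dg 7)) (Cy 4 0 5 8 2 3 1 6 7))
    (Cy 4 0 5 8 3 1 2 6 7)) (Cy 2 3 1 6 4 0 5 7 8))) (Sp 2 6 (Sp 4 7 (Sp 3 7 (Sp 7 0 (Sp 3 5 (Sp 2 7 (Dg 7)
    (Cy 4 0 1 8 2 3 5 6 7)) (Cy 4 5 3 8 0 1 2 6 7)) (Dg 7)) (Cy 0 1 2 8 3 4 5 6 7)) (Cy 4 5 6 7 0 1 2 3 8))
    (Cy 0 1 7 8 2 3 4 5 6))) (Dg 8)) (Dg 8)) (Sp 3 10 (Sp 1 5 (Sp 4 6 (Sp 4 5 (Sp 0 6 (Sp 6 2 (Sp 4 8 (Sp 0 8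
    (Dg 8) (Cy 2 3 4 6 0 1 5 7 8)) (Cy 6 2 3 10 4 0 1 7 8)) (Dg 6)) (Cy 7 8 3 10 0 1 4 5 6)) (Cy 4 0 1 5 6 7 8
    3 10)) (Cy 7 8 3 10 4 0 1 5 6)) (Cy 1 4 0 5 6 7 8 3 10)) (Sp 7 2 (Sp 4 8 (Sp 8 0 (Sp 5 3 (Sp 5 1 (Sp 6 4
    (Sp 1 3 (Cy 6 7 2 8 1 3 4 0 5) (Cy 2 3 1 7 0 5 6 4 8)) (Cy 0 5 1 8 2 3 4 6 7)) (Cy 6 7 2 8 3 4 0 1 5)) (Cy
    0 1 4 8 2 3 5 6 7)) (Dg 8)) (Sp 1 3 (Sp 5 3 (Sp 5 1 (Cy 6 7 2 8 1 3 4 0 5) (Cy 6 7 2 8 3 4 0 1 5)) (Cy 4 0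
    1 8 2 3 5 6 7)) (Cy 4 0 5 8 2 3 1 6 7))) (Sp 1 3 (Sp 2 6 (Sp 0 6 (Sp 6 4 (Sp 5 3 (Sp 6 3 (Sp 3 0 (Sp 5 4
    (Sp 10 4 (Sp 3 7 (Sp 7 4 (Sp 4 2 (Sp 1 5 (Cy 4 2 6 7 3 0 1 5 8) (Cy 4 2 6 7 3 0 5 1 8)) (Dg 4)) (Dg 7))
    (Dg 3)) (Cy 0 1 2 3 7 8 6 4 10)) (Cy 0 1 2 3 6 4 5 7 8)) (Dg 3)) (Dg 6)) (Cy 3 5 7 8 4 0 1 2 6)) (Dg 6))
    (Sp 10 4 (Sp 5 4 (Sp 7 4 (Sp 8 4 (Sp 4 2 (Sp 5 1 (Cy 0 5 1 6 3 4 2 7 8) (Cy 0 1 5 6 3 4 2 7 8)) (Dg 4))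
    (Sp 8 0 (Sp 5 3 (Sp 3 6 (Sp 6 4 (Sp 4 2 (Sp 5 1 (Cy 0 5 1 6 3 4 2 7 8) (Cy 0 1 5 8 4 2 3 6 7)) (Dg 4)) (Dg
    6)) (Sp 3 7 (Sp 1 5 (Sp 3 0 (Sp 5 2 (Cy 6 7 4 8 2 3 0 1 5) (Cy 6 3 7 8 4 0 1 2 5)) (Dg 3)) (Cy 3 7 4 8 0 5
    1 2 6)) (Dg 3))) (Cy 0 1 2 6 3 5 7 4 8)) (Dg 8))) (Sp 5 2 (Sp 1 5 (Cy 3 4 7 8 0 1 5 2 6) (Cy 3 4 7 8 0 5 1
    2 6)) (Cy 3 4 7 8 0 1 2 5 6))) (Cy 0 1 2 6 3 4 5 7 8)) (Cy 0 1 2 6 7 8 3 4 10))) (Sp 5 2 (Sp 1 5 (Sp 3 5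
    (Sp 4 7 (Sp 0 7 (Dg 7) (Cy 0 1 4 7 6 2 3 5 8)) (Cy 3 5 2 8 4 0 1 6 7)) (Cy 6 2 7 8 3 4 0 1 5)) (Cy 6 2 7 8
    1 3 4 0 5)) (Cy 0 1 3 4 6 2 5 7 8))) (Sp 4 7 (Sp 7 3 (Sp 4 6 (Sp 7 0 (Sp 2 4 (Sp 4 5 (Sp 2 5 (Sp 0 8 (Sp 6
    2 (Cy 2 4 5 6 3 1 7 0 8) (Cy 3 4 5 8 0 1 2 6 7)) (Cy 3 4 6 7 0 1 2 5 8)) (Cy 0 1 6 7 3 4 5 2 8)) (Cy 3 1 2
    8 0 5 4 6 7)) (Cy 0 5 6 7 3 1 4 2 8)) (Dg 7)) (Cy 4 0 5 6 3 1 2 7 8)) (Dg 7)) (Cy 3 1 2 8 4 0 5 6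
    7))))))))))"

definition cert_triangle_point :: cert where
  "cert_triangle_point =
    Sp 0 8 (Sp 8 3 (Sp 5 2 (Sp 6 2 (Sp 10 2 (Sp 7 2 (Sp 8 1 (Sp 2 0 (Sp 7 4 (Sp 5 4 (Sp 6 3 (Sp 5 3 (Sp 6 4
    (Sp 10 3 (Sp 7 1 (Sp 7 3 (Sp 5 1 (Sp 6 1 (Sp 3 1 (Sp 10 1 (Dg 1) (Cy 3 4 0 8 5 6 7 1 10)) (Dg 3)) (Cy 1 6
    7 8 5 3 4 0 10)) (Cy 1 5 6 7 8 3 4 0 10)) (Cy 1 2 3 7 5 6 4 0 10)) (Cy 1 7 5 8 6 3 4 0 10)) (Cy 1 2 0 8 6
    7 5 3 10)) (Cy 5 4 6 7 8 1 2 0 10)) (Cy 7 4 0 10 1 2 3 5 8)) (Cy 7 4 0 10 1 2 3 6 8)) (Cy 3 4 5 8 6 7 2 0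
    10)) (Cy 3 4 7 8 5 6 2 0 10)) (Sp 7 1 (Sp 10 1 (Sp 5 1 (Sp 6 1 (Sp 2 8 (Sp 8 4 (Sp 6 3 (Sp 1 3 (Sp 7 3 (Sp
    5 3 (Sp 10 3 (Dg 3) (Cy 6 7 3 10 4 0 1 2 8)) (Cy 1 3 5 6 7 8 4 0 10)) (Cy 8 4 0 10 5 6 2 3 7)) (Dg 1)) (Cy
    8 4 0 10 1 2 3 6 7)) (Dg 8)) (Dg 2)) (Cy 0 2 3 4 1 6 7 5 8)) (Cy 0 2 3 4 1 5 6 7 8)) (Cy 0 2 3 4 5 6 7 1
    10)) (Cy 0 2 3 4 1 7 5 6 8))) (Sp 8 4 (Sp 7 3 (Sp 5 3 (Sp 10 3 (Sp 8 2 (Sp 2 4 (Sp 6 3 (Sp 3 1 (Sp 0 7 (Sp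
    6 1 (Sp 4 6 (Sp 0 3 (Dg 3) (Cy 1 2 4 6 3 0 7 5 8)) (Cy 2 3 1 8 5 6 4 0 10)) (Cy 2 4 0 8 5 3 1 6 7)) (Cy 2
    3 1 8 5 6 7 0 10)) (Dg 3)) (Cy 5 3 6 7 8 2 4 0 10)) (Dg 2)) (Dg 8)) (Cy 4 0 1 8 6 7 2 3 10)) (Cy 2 3 5 6 7
    8 4 0 10)) (Cy 4 0 1 8 5 6 2 3 7)) (Dg 8))) (Cy 5 6 2 7 8 3 4 0 10)) (Cy 3 4 0 8 7 5 6 2 10)) (Cy 5 2 6 7
    8 3 4 0 10)) (Sp 2 7 (Sp 1 6 (Sp 2 6 (Sp 2 8 (Sp 8 1 (Sp 3 6 (Sp 4 7 (Sp 4 6 (Sp 0 6 (Dg 6) (Cy 0 1 2 6 3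
    4 7 5 8)) (Cy 1 2 7 8 5 6 4 0 10)) (Cy 1 2 5 8 6 7 4 0 10)) (Cy 1 2 7 8 6 3 4 0 10)) (Dg 8)) (Sp 3 6 (Sp 3
    1 (Sp 4 6 (Sp 0 6 (Dg 6) (Cy 5 6 0 10 3 1 2 7 8)) (Cy 6 4 0 10 3 1 2 7 8)) (Cy 0 1 3 4 2 5 6 7 8)) (Cy 2 7
    5 8 6 3 4 0 10))) (Cy 5 6 2 7 8 3 4 0 10)) (Cy 3 4 0 8 5 6 1 2 7)) (Cy 2 5 6 7 8 3 4 0 10))) (Sp 8 2 (Sp 8
    4 (Sp 8 1 (Sp 0 5 (Sp 4 5 (Sp 4 7 (Sp 3 5 (Sp 1 6 (Sp 1 5 (Sp 5 2 (Cy 1 6 7 8 2 3 4 0 5) (Dg 5)) (Cy 5 1 6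
    7 2 3 4 0 8)) (Cy 8 4 0 10 1 2 3 5 6)) (Sp 6 2 (Sp 0 2 (Sp 10 2 (Sp 6 1 (Sp 7 1 (Sp 7 2 (Sp 5 2 (Dg 2) (Cy
    8 4 0 10 1 2 5 6 7)) (Cy 8 4 0 10 5 6 1 2 7)) (Cy 5 6 1 7 4 0 2 3 8)) (Cy 0 2 3 4 1 6 7 5 8)) (Cy 5 3 4 7
    6 8 1 2 10)) (Cy 6 2 0 10 4 7 5 3 8)) (Cy 1 2 6 8 5 3 4 0 10))) (Cy 1 2 3 8 6 7 4 0 10)) (Cy 1 2 3 8 7 5 4
    0 10)) (Cy 1 2 3 8 6 7 5 0 10)) (Dg 8)) (Dg 8)) (Dg 8))) (Sp 1 4 (Sp 5 4 (Sp 8 3 (Sp 5 2 (Sp 7 4 (Sp 6 2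
    (Sp 7 2 (Sp 6 4 (Sp 3 5 (Sp 8 4 (Cy 2 3 5 6 7 8 4 0 10) (Cy 0 1 4 8 2 3 5 6 7)) (Sp 7 1 (Sp 7 3 (Sp 6 3
    (Sp 5 1 (Sp 6 1 (Sp 5 0 (Sp 3 10 (Sp 4 2 (Sp 8 2 (Sp 0 2 (Sp 2 10 (Sp 1 3 (Cy 0 1 3 4 6 7 5 2 10) (Cy 2 3
    1 4 6 7 5 0 10)) (Dg 2)) (Cy 2 0 1 4 5 6 7 3 10)) (Cy 5 6 3 10 0 1 4 2 8)) (Cy 0 1 2 4 7 5 6 3 10)) (Sp 3
    0 (Sp 10 4 (Sp 4 2 (Sp 1 3 (Dg 3) (Cy 2 3 1 4 6 7 5 0 10)) (Dg 4)) (Cy 0 1 2 3 5 6 7 4 10)) (Dg 3))) (Sp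
    10 3 (Sp 10 4 (Sp 4 2 (Sp 1 3 (Dg 3) (Cy 2 3 1 4 5 6 8 0 10)) (Dg 4)) (Cy 0 5 6 8 7 2 3 4 10)) (Cy 7 2 3
    10 1 4 0 5 6))) (Cy 5 1 6 7 8 3 4 0 10)) (Cy 1 5 6 7 8 3 4 0 10)) (Cy 5 4 0 10 1 2 3 6 7)) (Cy 1 2 3 7 5 6
    4 0 10)) (Sp 1 3 (Sp 10 3 (Sp 1 6 (Sp 10 4 (Sp 4 2 (Sp 4 8 (Sp 6 3 (Sp 7 3 (Dg 3) (Cy 6 8 0 10 5 4 2 3 7))
    (Cy 0 1 4 8 5 2 3 6 7)) (Dg 4)) (Dg 4)) (Cy 0 1 6 8 7 5 3 4 10)) (Cy 5 6 1 7 8 3 4 0 10)) (Cy 6 2 3 10 5 4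
    0 1 7)) (Cy 6 4 0 10 5 2 3 1 7)))) (Cy 2 3 4 6 7 5 8 0 10)) (Cy 5 6 2 7 8 3 4 0 10)) (Cy 5 2 6 7 8 3 4 0
    10)) (Cy 6 8 0 10 5 2 3 4 7)) (Sp 6 3 (Sp 2 7 (Sp 10 3 (Sp 1 8 (Sp 2 6 (Sp 2 4 (Sp 5 3 (Sp 1 3 (Sp 3 7 (Cy
    0 1 2 4 3 7 5 6 8) (Dg 3)) (Cy 7 8 0 10 3 1 2 5 6)) (Cy 0 1 2 4 3 5 6 7 8)) (Cy 3 4 2 6 7 5 8 0 10)) (Cy 5
    6 2 7 3 4 0 1 8)) (Cy 1 2 5 8 6 3 4 0 10)) (Cy 6 8 3 10 4 0 1 2 5)) (Cy 2 5 6 7 8 3 4 0 10)) (Cy 3 6 7 8 4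
    0 1 2 5))) (Sp 10 4 (Sp 6 4 (Sp 1 8 (Sp 7 4 (Sp 4 8 (Dg 8) (Dg 4)) (Cy 5 6 4 7 0 1 2 3 8)) (Cy 1 2 3 8 5 6
    4 0 10)) (Cy 5 4 6 7 0 1 2 3 8)) (Cy 7 5 4 10 0 1 2 3 8))) (Sp 1 5 (Sp 2 5 (Sp 2 6 (Sp 3 7 (Sp 6 0 (Sp 2 8
    (Sp 1 8 (Sp 8 3 (Sp 2 7 (Sp 3 6 (Sp 4 2 (Cy 3 7 5 8 0 1 4 2 6) (Cy 0 1 2 4 3 6 7 5 8)) (Cy 3 4 5 6 0 1 2 7
    8)) (Cy 3 7 2 8 0 1 4 5 6)) (Dg 8)) (Cy 5 6 0 10 1 2 3 7 8)) (Cy 2 3 7 8 0 1 4 5 6)) (Sp 3 5 (Sp 5 0 (Sp 1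
    6 (Sp 6 4 (Sp 3 8 (Sp 1 8 (Sp 2 8 (Dg 8) (Cy 2 3 7 8 4 5 0 1 6)) (Cy 6 4 0 10 1 2 3 7 8)) (Cy 3 7 5 8 4 0
    1 2 6)) (Sp 2 7 (Sp 6 3 (Cy 3 4 5 6 0 1 2 7 8) (Dg 6)) (Cy 0 1 5 8 2 3 4 6 7))) (Cy 7 8 0 10 1 2 3 5 6))
    (Dg 5)) (Sp 7 4 (Cy 4 5 3 7 0 1 2 6 8) (Cy 5 3 4 7 0 1 2 6 8)))) (Sp 1 3 (Sp 2 8 (Cy 0 1 2 8 3 4 5 6 7)
    (Cy 0 1 3 4 2 6 7 5 8)) (Cy 5 8 0 10 3 1 2 6 7))) (Cy 7 8 0 10 2 3 4 5 6)) (Cy 2 3 4 5 6 7 8 0 10)) (Cy 6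
    8 0 10 1 2 3 4 5))) (Cy 1 2 3 4 5 6 8 0 10))"

definition cert_triangle_point_only :: cert where
  "cert_triangle_point_only =
    Sp 8 0 (Sp 1 4 (Sp 4 2 (Sp 1 3 (Sp 2 8 (Sp 5 3 (Sp 6 4 (Sp 6 3 (Sp 7 3 (Sp 5 4 (Sp 7 4 (Sp 3 8 (Sp 4 8 (Dg
    8) (Dg 4)) (Dg 3)) (Cy 0 1 2 8 5 6 3 4 7)) (Cy 0 1 2 8 3 4 5 6 7)) (Cy 5 6 3 7 0 1 4 2 8)) (Cy 5 3 6 7 0 1
    4 2 8)) (Cy 0 1 2 8 5 3 4 6 7)) (Sp 3 7 (Sp 1 7 (Sp 3 6 (Sp 4 6 (Sp 2 5 (Sp 2 6 (Sp 4 7 (Sp 0 3 (Sp 1 6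
    (Sp 1 5 (Sp 4 5 (Dg 5) (Cy 4 2 3 5 0 1 6 7 8)) (Cy 5 1 6 7 0 3 4 2 8)) (Cy 0 3 7 8 1 4 2 5 6)) (Sp 4 8 (Sp
    8 1 (Sp 2 7 (Sp 0 7 (Dg 7) (Cy 0 5 6 7 1 2 3 4 8)) (Cy 2 3 6 7 1 4 0 5 8)) (Dg 8)) (Cy 0 1 2 3 4 7 5 6
    8))) (Cy 4 2 6 7 0 1 3 5 8)) (Cy 2 3 4 6 0 1 7 5 8)) (Cy 5 2 3 7 0 1 4 6 8)) (Cy 4 2 3 6 0 1 7 5 8)) (Cy 5
    6 3 7 0 1 4 2 8)) (Cy 0 5 6 8 1 4 2 3 7)) (Cy 3 5 6 7 0 1 4 2 8))) (Sp 7 2 (Sp 5 2 (Sp 6 2 (Dg 2) (Cy 0 1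
    3 4 2 6 7 5 8)) (Cy 0 1 3 4 2 5 6 7 8)) (Cy 0 1 3 4 2 7 5 6 8))) (Cy 2 3 1 4 0 5 6 7 8)) (Sp 3 8 (Sp 4 8
    (Sp 8 2 (Sp 8 1 (Sp 0 7 (Sp 0 6 (Sp 4 5 (Sp 4 6 (Sp 1 5 (Sp 2 7 (Sp 1 6 (Sp 3 1 (Sp 2 6 (Sp 3 6 (Dg 6) (Cy
    1 2 7 8 3 4 0 5 6)) (Cy 0 7 5 8 2 3 1 4 6)) (Cy 0 1 3 4 2 7 5 6 8)) (Cy 0 7 5 8 1 2 3 4 6)) (Cy 1 5 6 8 2
    3 4 0 7)) (Cy 0 6 7 8 1 2 3 4 5)) (Cy 1 2 3 8 5 6 4 0 7)) (Cy 1 2 3 8 5 4 0 6 7)) (Cy 5 6 0 7 1 2 3 4 8))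
    (Cy 0 5 6 7 1 2 3 4 8)) (Dg 8)) (Dg 8)) (Sp 4 5 (Sp 0 3 (Sp 4 7 (Sp 4 6 (Sp 1 7 (Sp 2 6 (Sp 3 5 (Sp 1 5
    (Sp 5 2 (Sp 6 1 (Cy 1 5 2 6 0 3 4 7 8) (Cy 0 1 6 8 5 2 3 4 7)) (Dg 5)) (Cy 4 0 3 8 5 1 2 6 7)) (Cy 5 3 4 7
    0 1 2 6 8)) (Cy 2 3 4 6 0 1 7 5 8)) (Cy 0 5 6 8 1 2 3 4 7)) (Cy 5 6 4 7 0 1 2 3 8)) (Cy 4 5 6 7 0 1 2 3
    8)) (Cy 0 1 2 3 4 5 6 7 8)) (Sp 4 6 (Cy 5 4 6 7 0 1 2 3 8) (Dg 4)))) (Sp 7 3 (Sp 6 3 (Sp 5 3 (Sp 3 1 (Sp 7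
    4 (Sp 3 0 (Sp 8 2 (Sp 6 2 (Sp 7 1 (Sp 6 4 (Sp 4 8 (Sp 8 1 (Cy 1 2 4 8 3 0 5 6 7) (Cy 2 3 1 8 4 0 5 6 7))
    (Dg 4)) (Cy 3 0 5 8 1 2 4 6 7)) (Cy 3 1 7 8 2 4 0 5 6)) (Cy 2 6 7 8 3 1 4 0 5)) (Cy 3 1 2 8 4 0 5 6 7))
    (Dg 3)) (Cy 0 5 6 8 3 1 2 4 7)) (Dg 3)) (Cy 0 1 2 4 3 5 6 7 8)) (Cy 0 1 2 4 3 6 7 5 8)) (Cy 0 1 2 4 3 7 5
    6 8)))) (Cy 1 2 3 4 0 5 6 7 8)) (Sp 3 8 (Sp 8 1 (Sp 4 7 (Sp 8 4 (Sp 0 3 (Sp 8 2 (Sp 1 3 (Sp 6 2 (Sp 5 2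
    (Sp 6 1 (Sp 0 2 (Sp 7 2 (Dg 2) (Cy 4 0 3 8 5 6 1 2 7)) (Cy 2 0 5 6 1 3 4 7 8)) (Cy 1 6 7 8 2 3 4 0 5)) (Cy
    0 1 3 4 2 5 6 7 8)) (Cy 0 1 3 4 2 6 7 5 8)) (Sp 0 2 (Sp 7 1 (Sp 6 1 (Sp 5 1 (Dg 1) (Cy 1 5 6 7 2 3 4 0 8))
    (Cy 0 2 3 4 1 6 7 5 8)) (Cy 0 2 3 4 1 7 5 6 8)) (Cy 1 2 0 3 4 7 5 6 8))) (Dg 8)) (Cy 0 1 2 3 4 7 5 6 8))
    (Dg 8)) (Cy 1 2 3 8 4 0 5 6 7)) (Dg 8)) (Sp 4 8 (Sp 8 2 (Sp 8 1 (Sp 0 7 (Sp 0 6 (Sp 1 5 (Sp 1 7 (Sp 2 7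
    (Sp 3 6 (Sp 1 6 (Sp 2 0 (Sp 4 5 (Sp 2 6 (Sp 6 4 (Sp 3 7 (Cy 2 3 7 8 4 0 1 5 6) (Cy 1 2 0 8 3 4 5 6 7)) (Dg
    6)) (Cy 1 7 5 8 2 3 4 0 6)) (Cy 4 0 1 5 2 3 6 7 8)) (Cy 0 2 3 4 1 7 5 6 8)) (Cy 3 4 0 8 5 6 1 2 7)) (Cy 3
    4 0 6 1 2 7 5 8)) (Cy 1 5 6 8 2 3 4 0 7)) (Cy 1 5 6 7 2 3 4 0 8)) (Sp 7 2 (Sp 6 1 (Sp 7 1 (Sp 6 2 (Sp 1 4
    (Sp 5 2 (Sp 2 0 (Sp 1 3 (Cy 1 3 4 8 5 2 0 6 7) (Cy 3 1 4 8 5 6 2 0 7)) (Dg 2)) (Cy 1 2 5 6 3 4 0 7 8)) (Dg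
    1)) (Cy 1 2 6 7 3 4 0 5 8)) (Cy 5 6 1 7 2 3 4 0 8)) (Cy 5 1 6 7 2 3 4 0 8)) (Cy 5 1 2 7 3 4 0 6 8))) (Cy 5
    6 0 7 1 2 3 4 8)) (Cy 0 5 6 7 1 2 3 4 8)) (Dg 8)) (Dg 8)) (Sp 4 2 (Sp 3 0 (Sp 5 4 (Sp 6 4 (Sp 7 4 (Sp 4 1
    (Sp 6 2 (Sp 7 1 (Sp 5 1 (Sp 7 3 (Sp 7 2 (Sp 8 2 (Sp 2 0 (Sp 6 1 (Sp 8 1 (Dg 1) (Cy 3 4 1 8 2 0 5 6 7)) (Cy
    2 3 0 8 5 4 1 6 7)) (Dg 2)) (Cy 4 1 2 8 3 0 5 6 7)) (Cy 4 1 2 7 3 0 5 6 8)) (Cy 1 2 3 7 4 0 5 6 8)) (Cy 1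
    5 6 7 4 2 3 0 8)) (Cy 4 1 7 8 2 3 0 5 6)) (Cy 3 0 5 8 4 1 2 6 7)) (Dg 4)) (Cy 0 1 2 3 4 7 5 6 8)) (Cy 0 1
    2 3 4 6 7 5 8)) (Cy 0 1 2 3 4 5 6 7 8)) (Sp 1 7 (Sp 1 6 (Sp 1 3 (Sp 2 8 (Sp 8 1 (Sp 2 0 (Cy 2 0 3 4 1 6 7
    5 8) (Cy 0 2 3 4 1 7 5 6 8)) (Dg 8)) (Sp 6 2 (Sp 7 2 (Sp 2 5 (Cy 0 1 3 4 2 5 6 7 8) (Dg 2)) (Cy 0 1 3 4 2
    7 5 6 8)) (Cy 0 1 3 4 2 6 7 5 8))) (Sp 2 7 (Sp 0 6 (Sp 3 7 (Sp 2 5 (Sp 0 7 (Sp 4 7 (Dg 7) (Cy 4 0 6 7 3 1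
    2 5 8)) (Cy 4 2 5 8 0 3 1 6 7)) (Cy 4 0 6 8 5 2 3 1 7)) (Cy 3 1 2 7 4 0 5 6 8)) (Cy 0 3 1 6 4 2 7 5 8))
    (Cy 2 3 1 7 4 0 5 6 8))) (Sp 2 8 (Sp 0 2 (Cy 5 6 1 7 3 4 0 2 8) (Cy 5 6 1 7 3 4 2 0 8)) (Cy 5 6 1 7 2 3 4
    0 8))) (Sp 6 2 (Sp 6 3 (Sp 7 3 (Sp 3 1 (Sp 7 2 (Sp 3 5 (Sp 8 2 (Sp 2 5 (Cy 3 4 0 8 1 2 5 6 7) (Dg 2)) (Cy
    3 5 6 7 4 0 1 2 8)) (Dg 3)) (Cy 3 1 2 7 4 0 5 6 8)) (Dg 3)) (Cy 1 2 3 7 4 0 5 6 8)) (Cy 4 0 5 8 1 2 3 6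
    7)) (Cy 1 2 6 7 3 4 0 5 8)))) (Sp 6 3 (Sp 7 3 (Sp 5 3 (Sp 3 1 (Sp 6 2 (Sp 7 1 (Sp 3 0 (Sp 5 4 (Sp 7 4 (Sp
    6 4 (Dg 4) (Cy 3 0 5 8 1 2 4 6 7)) (Cy 0 1 2 3 4 7 5 6 8)) (Cy 0 1 2 3 4 5 6 7 8)) (Dg 3)) (Cy 3 1 7 8 2 4
    0 5 6)) (Cy 4 0 5 8 3 1 2 6 7)) (Dg 3)) (Cy 0 1 2 4 3 5 6 7 8)) (Cy 0 1 2 4 3 7 5 6 8)) (Cy 0 1 2 4 3 6 7
    5 8)))))"

definition cert_triangle_points :: cert where
  "cert_triangle_points =
    Sp 9 0 (Sp 1 4 (Sp 4 7 (Sp 1 8 (Sp 2 5 (Sp 2 8 (Sp 3 8 (Sp 8 0 (Sp 4 6 (Sp 8 4 (Cy 4 6 7 8 0 1 2 5 9) (Dg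
    8)) (Cy 5 6 4 7 0 1 2 3 8)) (Dg 8)) (Cy 3 4 7 8 0 1 2 5 9)) (Cy 2 5 6 8 0 1 4 7 9)) (Cy 0 1 8 9 5 2 3 4
    7)) (Cy 1 4 7 8 5 6 9 0 10)) (Sp 5 2 (Sp 5 4 (Sp 7 3 (Sp 6 4 (Sp 6 3 (Sp 5 3 (Sp 8 3 (Sp 6 2 (Sp 7 2 (Sp 8
    4 (Sp 4 2 (Sp 1 3 (Sp 10 2 (Sp 8 2 (Sp 2 9 (Sp 10 3 (Sp 3 9 (Sp 1 9 (Dg 9) (Cy 1 2 3 9 5 6 4 0 10)) (Dg
    3)) (Cy 0 1 2 9 5 6 8 3 10)) (Dg 2)) (Cy 3 4 2 8 5 6 9 0 10)) (Cy 0 1 3 4 7 5 6 2 10)) (Cy 2 3 1 4 5 6 9 0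
    10)) (Sp 10 3 (Sp 4 10 (Sp 0 3 (Sp 9 3 (Dg 3) (Cy 5 8 4 10 0 1 2 3 9)) (Cy 0 1 2 3 7 5 6 4 10)) (Dg 4))
    (Cy 0 1 2 4 6 7 5 3 10))) (Sp 10 3 (Sp 1 3 (Sp 3 9 (Sp 3 0 (Sp 1 9 (Sp 9 4 (Sp 0 5 (Sp 2 8 (Sp 2 9 (Dg 9)
    (Cy 2 8 3 9 4 0 5 6 7)) (Cy 2 3 4 8 0 5 6 7 9)) (Cy 4 8 3 9 6 7 5 0 10)) (Dg 9)) (Cy 1 4 8 9 5 6 3 0 10))
    (Dg 3)) (Dg 3)) (Cy 3 1 4 8 5 6 9 0 10)) (Cy 6 7 3 10 0 1 4 8 9))) (Cy 5 6 2 7 8 3 4 0 10)) (Cy 5 2 6 7 8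
    3 4 0 10)) (Sp 1 9 (Sp 1 8 (Sp 2 9 (Sp 10 3 (Sp 10 4 (Sp 9 4 (Sp 9 3 (Sp 1 3 (Sp 2 8 (Sp 3 0 (Sp 2 4 (Dg
    4) (Cy 4 2 8 9 7 5 3 0 10)) (Dg 3)) (Cy 3 8 2 9 6 7 4 0 10)) (Cy 3 1 2 9 7 5 4 0 10)) (Dg 9)) (Dg 9)) (Cy
    0 1 8 9 6 7 3 4 10)) (Cy 0 1 8 9 7 5 2 3 10)) (Cy 2 3 8 9 5 6 4 0 10)) (Cy 1 2 3 8 5 6 4 0 10)) (Cy 7 4 0
    10 1 2 3 8 9))) (Sp 2 7 (Cy 3 5 2 7 6 8 9 0 10) (Cy 8 9 0 10 2 3 5 6 7))) (Cy 8 9 0 10 5 2 3 6 7)) (Cy 3 4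
    6 7 5 8 9 0 10)) (Cy 5 2 3 7 6 8 9 0 10)) (Cy 2 3 4 5 6 7 9 0 10)) (Sp 1 9 (Sp 2 9 (Sp 2 4 (Sp 10 4 (Sp 9
    4 (Sp 2 7 (Sp 2 8 (Sp 5 4 (Sp 6 4 (Dg 4) (Cy 5 4 6 7 0 1 2 8 9)) (Cy 4 5 6 7 0 1 2 8 9)) (Cy 4 0 1 9 2 7 5
    6 8)) (Cy 2 5 6 7 8 9 4 0 10)) (Dg 9)) (Cy 0 1 2 9 5 6 7 4 10)) (Cy 8 9 0 10 4 2 5 6 7)) (Cy 2 5 8 9 6 7 4
    0 10)) (Cy 1 2 5 9 6 7 4 0 10)))) (Cy 1 2 3 4 5 6 9 0 10)) (Sp 9 3 (Sp 6 2 (Sp 10 2 (Sp 7 2 (Sp 5 2 (Sp 2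
    9 (Sp 9 1 (Sp 9 4 (Sp 6 3 (Sp 5 3 (Sp 6 1 (Sp 10 1 (Sp 10 3 (Sp 7 3 (Sp 7 1 (Sp 5 1 (Sp 8 2 (Sp 8 1 (Sp 1
    3 (Sp 8 3 (Dg 3) (Cy 1 2 3 8 5 9 4 0 10)) (Dg 1)) (Cy 1 8 2 9 7 3 4 0 10)) (Cy 1 2 8 9 5 3 4 0 10)) (Cy 1
    5 6 7 9 3 4 0 10)) (Cy 5 6 1 7 9 3 4 0 10)) (Cy 5 6 3 7 8 9 4 0 10)) (Cy 5 6 3 10 4 0 1 2 9)) (Cy 3 4 0 9
    7 5 6 1 10)) (Cy 1 6 2 9 5 3 4 0 10)) (Cy 2 3 5 6 7 9 4 0 10)) (Cy 9 4 0 10 5 2 3 6 7)) (Dg 9)) (Dg 9))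
    (Sp 4 5 (Sp 0 7 (Sp 0 2 (Sp 2 8 (Sp 0 8 (Sp 2 4 (Sp 10 3 (Sp 7 3 (Sp 5 3 (Sp 1 9 (Sp 6 3 (Sp 0 3 (Sp 1 8
    (Sp 1 3 (Dg 3) (Cy 3 1 8 9 5 2 4 0 10)) (Cy 2 8 1 9 5 3 4 0 10)) (Cy 2 4 5 6 7 9 3 0 10)) (Cy 5 3 6 7 2 4
    0 8 9)) (Cy 1 2 8 9 5 3 4 0 7)) (Cy 3 5 8 9 6 2 4 0 10)) (Cy 0 1 2 4 3 7 5 6 9)) (Cy 8 9 3 10 2 4 5 6 7))
    (Dg 2)) (Cy 0 1 2 8 3 4 5 6 9)) (Dg 2)) (Cy 6 2 0 10 3 4 5 8 9)) (Cy 6 7 0 10 2 3 4 5 9)) (Sp 8 3 (Sp 7 3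
    (Sp 6 3 (Sp 1 3 (Sp 1 9 (Sp 9 4 (Sp 10 3 (Sp 5 3 (Dg 3) (Cy 4 0 1 9 2 3 5 6 7)) (Cy 4 0 1 9 5 6 8 3 10))
    (Dg 9)) (Sp 8 2 (Sp 2 4 (Sp 5 3 (Sp 10 3 (Dg 3) (Cy 0 1 2 4 5 6 8 3 10)) (Cy 3 5 6 9 8 2 4 0 10)) (Dg 2))
    (Cy 1 2 8 9 7 3 4 0 10))) (Sp 8 2 (Sp 6 1 (Sp 7 1 (Sp 5 1 (Sp 8 1 (Sp 10 1 (Sp 2 0 (Sp 8 4 (Sp 9 1 (Dg 1)
    (Cy 2 3 1 9 5 8 4 0 10)) (Cy 3 4 8 9 6 1 2 0 10)) (Dg 2)) (Cy 6 7 1 10 2 3 4 0 9)) (Cy 5 4 0 10 2 3 1 8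
    9)) (Cy 1 5 6 7 9 3 4 0 10)) (Cy 5 6 1 7 8 3 4 0 10)) (Cy 3 1 6 8 7 5 4 0 10)) (Cy 5 4 0 10 3 1 2 8 9)))
    (Cy 2 3 6 9 7 5 4 0 10)) (Cy 5 4 0 10 2 3 7 8 9)) (Cy 2 3 8 9 7 5 4 0 10)))) (Cy 2 5 6 7 9 3 4 0 10)) (Cy
    5 6 2 7 9 3 4 0 10)) (Cy 3 4 0 9 7 5 6 2 10)) (Sp 2 8 (Sp 1 5 (Sp 1 8 (Sp 2 5 (Sp 1 7 (Sp 1 6 (Sp 2 7 (Sp
    5 4 (Sp 1 3 (Sp 2 9 (Sp 7 3 (Sp 1 9 (Dg 9) (Cy 1 6 8 9 7 3 4 0 10)) (Cy 3 7 8 9 4 0 1 2 5)) (Cy 0 1 3 4 2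
    5 6 7 9)) (Cy 5 4 0 10 3 1 2 8 9)) (Sp 0 7 (Sp 0 8 (Sp 8 4 (Sp 1 3 (Sp 2 9 (Sp 7 3 (Sp 1 9 (Dg 9) (Cy 1 2
    8 9 7 3 4 0 10)) (Cy 3 7 5 9 4 0 1 6 8)) (Cy 0 1 3 4 2 7 5 6 9)) (Cy 4 0 7 8 3 1 5 6 9)) (Dg 8)) (Cy 0 1 7
    8 3 4 5 6 9)) (Cy 0 1 6 7 3 4 5 8 9))) (Cy 2 5 6 7 9 3 4 0 10)) (Cy 5 6 1 7 9 3 4 0 10)) (Cy 1 5 6 7 9 3 4
    0 10)) (Cy 5 2 6 7 9 3 4 0 10)) (Cy 3 4 0 9 1 2 6 7 8)) (Cy 3 4 0 9 5 1 2 6 7)) (Cy 2 6 7 8 9 3 4 0 10)))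
    (Sp 9 2 (Sp 9 1 (Sp 0 7 (Sp 9 4 (Sp 4 7 (Sp 4 8 (Sp 0 5 (Sp 0 8 (Sp 3 5 (Sp 2 6 (Sp 1 8 (Sp 8 3 (Cy 1 2 6
    9 3 4 0 5 8) (Dg 8)) (Cy 1 2 6 8 5 9 4 0 10)) (Cy 2 3 5 6 7 9 4 0 10)) (Sp 0 2 (Sp 7 2 (Sp 10 2 (Sp 5 2
    (Sp 6 2 (Sp 6 3 (Sp 8 2 (Dg 2) (Cy 1 2 8 9 6 3 4 0 10)) (Cy 2 3 6 7 4 0 5 8 9)) (Cy 3 4 0 5 1 2 6 7 9))
    (Cy 2 5 6 7 8 9 4 0 10)) (Cy 4 0 8 9 5 6 7 2 10)) (Cy 1 2 7 9 5 3 4 0 10)) (Cy 5 3 4 7 9 1 2 0 10))) (Cy 1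
    2 3 9 5 6 8 0 10)) (Cy 7 5 0 10 2 3 4 8 9)) (Cy 1 2 3 9 4 0 7 5 8)) (Cy 1 2 3 9 6 7 4 0 10)) (Dg 9)) (Cy 1
    2 3 9 5 6 7 0 10)) (Dg 9)) (Dg 9)))"

definition cert_triangle_points_only :: cert where
  "cert_triangle_points_only =
    Sp 9 0 (Sp 1 4 (Sp 8 4 (Sp 9 3 (Sp 1 8 (Sp 6 3 (Sp 7 4 (Sp 7 3 (Sp 5 4 (Sp 5 3 (Sp 6 4 (Sp 4 2 (Sp 8 3 (Sp
    1 3 (Dg 3) (Cy 0 5 6 9 4 2 3 1 8)) (Cy 4 2 3 8 0 5 6 7 9)) (Dg 4)) (Cy 0 1 8 9 5 3 4 6 7)) (Cy 4 0 1 8 3 5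
    6 7 9)) (Cy 0 1 8 9 3 4 5 6 7)) (Cy 4 0 1 8 3 7 5 6 9)) (Cy 0 1 8 9 5 6 3 4 7)) (Cy 4 0 1 8 3 6 7 5 9))
    (Sp 6 1 (Sp 7 3 (Sp 6 3 (Sp 6 2 (Sp 7 2 (Sp 8 3 (Sp 6 4 (Sp 7 4 (Sp 9 4 (Sp 4 5 (Sp 8 2 (Sp 4 2 (Sp 9 2
    (Sp 1 3 (Sp 2 5 (Cy 0 1 3 4 2 5 6 7 8) (Dg 2)) (Cy 2 3 1 4 0 5 6 7 9)) (Cy 0 1 2 9 3 4 5 6 8)) (Dg 4)) (Cy
    3 4 5 6 0 1 2 8 9)) (Dg 4)) (Sp 5 3 (Sp 3 0 (Sp 5 4 (Sp 4 2 (Sp 3 1 (Cy 2 3 1 4 0 5 6 7 9) (Dg 3)) (Dg 4))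
    (Cy 0 1 2 3 4 5 6 7 8)) (Dg 3)) (Cy 0 1 4 9 3 5 6 7 8))) (Cy 2 3 4 7 0 5 6 8 9)) (Cy 0 5 8 9 1 2 3 4 6))
    (Cy 1 2 3 8 0 5 6 7 9)) (Cy 1 2 7 8 3 4 0 5 6)) (Cy 1 2 6 8 3 4 0 5 9)) (Cy 3 6 7 9 1 4 0 5 8)) (Cy 3 7 8
    9 1 4 0 5 6)) (Cy 1 6 7 8 3 4 0 5 9))) (Sp 7 4 (Sp 1 9 (Sp 9 2 (Sp 9 4 (Sp 1 3 (Sp 6 4 (Sp 4 5 (Cy 0 1 3 9
    4 5 6 7 8) (Dg 4)) (Cy 0 1 3 9 4 6 7 5 8)) (Cy 2 3 1 9 4 0 5 6 8)) (Dg 9)) (Dg 9)) (Cy 1 2 3 9 4 0 5 6 8))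
    (Cy 4 7 5 8 0 1 2 3 9))) (Sp 1 8 (Sp 2 8 (Sp 8 3 (Sp 1 3 (Sp 2 4 (Sp 6 3 (Sp 7 4 (Sp 7 3 (Sp 5 3 (Sp 3 9
    (Sp 1 9 (Sp 9 2 (Cy 2 8 3 9 4 0 5 6 7) (Dg 9)) (Cy 1 8 3 9 4 0 5 6 7)) (Dg 3)) (Cy 3 5 6 7 0 1 4 8 9)) (Cy
    5 6 3 7 0 1 4 8 9)) (Cy 0 1 8 9 5 6 3 4 7)) (Cy 0 1 2 4 3 6 7 5 8)) (Cy 3 4 2 8 0 5 6 7 9)) (Cy 3 1 2 8 0
    5 6 7 9)) (Dg 8)) (Cy 2 3 4 8 0 5 6 7 9)) (Cy 0 5 6 9 1 2 3 4 8))) (Cy 1 2 3 4 0 5 6 7 9)) (Sp 9 3 (Sp 4 9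
    (Sp 9 1 (Sp 0 8 (Sp 0 7 (Sp 9 2 (Sp 0 6 (Sp 4 6 (Sp 7 2 (Sp 6 1 (Sp 5 1 (Sp 0 2 (Sp 7 1 (Sp 6 2 (Sp 5 2
    (Sp 2 4 (Sp 5 3 (Sp 6 3 (Sp 8 2 (Dg 2) (Cy 1 2 8 9 3 4 0 5 6)) (Cy 5 3 6 7 2 4 0 8 9)) (Cy 3 5 6 9 1 2 4 0
    7)) (Dg 2)) (Cy 1 2 5 6 3 4 0 8 9)) (Cy 3 4 0 9 5 1 2 6 7)) (Cy 5 6 1 7 3 4 0 8 9)) (Cy 1 2 0 5 3 4 6 7
    9)) (Cy 1 5 8 9 2 3 4 6 7)) (Cy 1 6 8 9 2 3 4 0 7)) (Sp 3 8 (Sp 4 8 (Sp 1 6 (Sp 1 8 (Dg 8) (Cy 2 3 4 9 1 6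
    7 5 8)) (Cy 3 4 0 9 5 6 1 2 7)) (Cy 4 0 6 8 1 2 7 5 9)) (Cy 1 2 7 9 3 4 0 6 8))) (Sp 8 2 (Sp 6 2 (Sp 7 2
    (Sp 5 2 (Sp 7 1 (Sp 6 1 (Sp 5 1 (Sp 2 0 (Sp 3 1 (Sp 8 1 (Dg 1) (Cy 3 1 8 9 2 0 5 6 7)) (Cy 1 3 4 9 2 0 6 7
    8)) (Dg 2)) (Cy 1 5 6 7 2 3 4 0 8)) (Cy 1 6 8 9 2 3 4 0 7)) (Cy 1 7 5 9 2 3 4 0 6)) (Cy 3 4 0 9 2 5 6 7
    8)) (Cy 2 7 5 8 3 4 0 6 9)) (Cy 3 4 0 9 2 6 7 5 8)) (Cy 1 2 8 9 5 6 4 0 7))) (Cy 5 6 0 7 1 2 3 4 9)) (Dg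
    9)) (Cy 0 5 6 7 1 2 3 4 9)) (Cy 0 5 6 8 1 2 3 4 9)) (Dg 9)) (Sp 3 7 (Sp 1 8 (Sp 2 5 (Sp 2 8 (Sp 4 8 (Sp 0
    8 (Dg 8) (Cy 0 1 2 8 3 7 5 6 9)) (Cy 3 7 5 9 4 0 1 2 8)) (Cy 3 4 0 9 2 5 6 7 8)) (Cy 5 2 3 7 4 0 1 8 9))
    (Cy 4 0 5 9 1 2 3 7 8)) (Sp 5 2 (Sp 2 9 (Sp 5 3 (Sp 9 1 (Sp 7 1 (Sp 6 1 (Sp 6 3 (Sp 8 2 (Sp 8 1 (Sp 8 3
    (Sp 3 1 (Sp 5 1 (Dg 1) (Cy 3 4 0 9 1 5 6 7 8)) (Dg 3)) (Cy 1 2 3 8 4 0 5 6 9)) (Cy 1 8 2 9 3 4 0 5 6)) (Cy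
    1 2 8 9 3 4 0 5 6)) (Cy 5 3 6 7 4 0 1 2 9)) (Cy 3 4 0 5 1 6 7 8 9)) (Cy 1 7 8 9 2 3 4 0 5)) (Dg 9)) (Cy 3
    5 6 7 4 0 1 2 9)) (Sp 3 6 (Sp 1 6 (Sp 9 1 (Cy 1 6 7 9 2 3 4 0 5) (Cy 4 0 1 9 5 2 3 6 7)) (Cy 1 2 3 6 4 0 5
    8 9)) (Sp 7 2 (Sp 5 3 (Sp 6 2 (Sp 1 9 (Sp 3 8 (Sp 4 7 (Sp 0 2 (Sp 1 8 (Sp 0 3 (Sp 2 4 (Sp 1 3 (Dg 3) (Cy 3
    1 8 9 5 6 2 4 7)) (Dg 2)) (Cy 0 1 2 3 4 7 5 6 9)) (Cy 1 2 3 8 4 7 5 6 9)) (Cy 2 0 5 6 3 4 7 8 9)) (Cy 2 3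
    8 9 4 0 5 6 7)) (Sp 3 0 (Sp 7 4 (Sp 3 1 (Cy 2 3 1 9 4 0 5 6 7) (Dg 3)) (Cy 4 7 8 9 2 3 0 5 6)) (Dg 3)))
    (Sp 8 2 (Sp 2 0 (Sp 8 4 (Sp 6 4 (Sp 5 4 (Sp 7 4 (Sp 4 2 (Dg 2) (Dg 4)) (Cy 2 0 5 6 3 4 7 8 9)) (Cy 1 2 0 9
    3 4 5 6 7)) (Cy 3 4 6 7 2 0 5 8 9)) (Cy 3 4 8 9 2 0 5 6 7)) (Dg 2)) (Cy 1 2 8 9 3 4 0 5 6))) (Cy 3 4 0 5 2
    6 7 8 9)) (Sp 4 2 (Sp 9 1 (Sp 8 2 (Sp 6 2 (Dg 2) (Cy 2 6 7 8 3 4 0 5 9)) (Cy 1 2 8 9 3 4 0 5 6)) (Cy 4 0 1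
    9 2 3 5 6 7)) (Cy 0 1 2 4 3 5 6 7 9))) (Cy 2 7 8 9 3 4 0 5 6)))) (Sp 1 8 (Sp 5 3 (Sp 1 7 (Sp 2 9 (Sp 6 3
    (Sp 1 9 (Dg 9) (Cy 1 7 8 9 3 4 0 5 6)) (Cy 5 3 6 7 4 0 1 8 9)) (Cy 2 5 6 9 3 4 0 1 7)) (Cy 3 4 0 9 1 2 5 6
    7)) (Cy 3 5 6 7 4 0 1 8 9)) (Cy 3 4 0 9 1 2 5 6 8))))) (Sp 9 1 (Sp 9 4 (Sp 9 2 (Sp 0 8 (Sp 4 8 (Sp 0 7 (Sp
    4 6 (Sp 0 3 (Sp 4 7 (Sp 0 6 (Sp 4 5 (Sp 7 2 (Sp 6 3 (Sp 8 2 (Sp 5 3 (Sp 7 3 (Sp 6 1 (Sp 6 2 (Sp 0 2 (Sp 5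
    2 (Dg 2) (Cy 3 4 6 7 1 2 5 8 9)) (Cy 4 7 8 9 1 2 0 5 6)) (Cy 1 2 6 9 5 3 4 0 7)) (Cy 1 6 7 9 2 3 4 5 8))
    (Cy 4 0 6 9 2 3 7 5 8)) (Cy 2 3 5 8 4 0 6 7 9)) (Cy 1 2 8 9 5 6 3 4 7)) (Cy 2 3 6 7 4 0 5 8 9)) (Sp 3 8
    (Sp 2 6 (Sp 8 2 (Cy 4 0 3 9 2 6 7 5 8) (Dg 8)) (Cy 5 6 2 7 4 0 3 8 9)) (Cy 2 7 5 9 3 4 0 6 8))) (Cy 1 2 3
    9 5 4 0 6 7)) (Cy 5 6 0 7 2 3 4 8 9)) (Cy 1 2 3 9 4 0 5 6 7)) (Cy 0 1 2 3 4 6 7 5 9)) (Cy 1 2 3 9 5 6 4 0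
    7)) (Cy 0 5 6 7 2 3 4 8 9)) (Cy 1 2 3 9 4 0 5 6 8)) (Cy 1 2 3 9 0 5 6 7 8)) (Dg 9)) (Dg 9)) (Dg 9)))"

section \<open>Verification of the six certificates by evaluation\<close>

lemma check_points: "check 9 arcs_points cert_points"
  by code_simp

lemma check_triangle: "check 9 arcs_triangle cert_triangle"
  by code_simp

lemma check_triangle_point: "check 9 arcs_triangle_point cert_triangle_point"
  by code_simp

lemma check_triangle_point_only: "check 9 arcs_triangle_point_only cert_triangle_point_only"
  by code_simp

lemma check_triangle_points: "check 10 arcs_triangle_points cert_triangle_points"
  by code_simp

lemma check_triangle_points_only: "check 10 arcs_triangle_points_only cert_triangle_points_only"
  by code_simp

section \<open>Disjoint cycles of lengths 4 and 5\<close>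

context tournament_graph
begin

lemma strong_disjoint_cycles_4_5:
  assumes K: "K \<subseteq> V" "strong E K" "9 \<le> card K"
    and deg: "\<And>v. v \<in> K \<Longrightarrow> 3 \<le> card {w \<in> K. E v w}"
  shows "disjoint_cycles_4_5 K E"
proof (rule ccontr)
  assume none: "\<not> disjoint_cycles_4_5 K E"
  have finK: "finite K"
    using K(1) by (rule finite_subset_V)
  have "5 \<le> card K"
    using K(3) by simp
  then obtain s1 s2 s3 s4 s5 where S_cycle: "is_cycle K E [s1, s2, s3, s4, s5]"
    using strong_card_ge_5_cycle[OF K(2,1)] by metis
  define S where "S = {s1, s2, s3, s4, s5}"
  define X where "X = K - S"
  have SK: "S \<subseteq> K" and card_S: "card S = 5"
    using S_cycle by (auto simp: S_def is_cycle_5)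
  have X: "X \<subseteq> V" "X \<subseteq> K"
    using K(1) by (auto simp: X_def)
  have "4 \<le> card X"
    using K(3) card_S SK finK by (simp add: X_def card_Diff_subset finite_subset)
  \<comment> \<open>Ensures that vertices are left over after three single-vertex components, or one
    triangle, have been peeled off.\<close>
  then have large: "X \<noteq> set ys" if "length ys < 4" for ys
    using card_length[of ys] that by auto
  have no_4_cycle: "\<not> is_cycle A E [p, q, r, t]" if "A \<subseteq> X" for A p q r t
  proof
    assume A: "is_cycle A E [p, q, r, t]"
    then have "is_cycle K E [p, q, r, t]"
      using is_cycle_mono that X(2) by blast
    moreover from A have "set [p, q, r, t] \<inter> set [s1, s2, s3, s4, s5] = {}"
      using that by (auto simp: is_cycle_4 X_def S_def)
    ultimately have "disjoint_cycles_4_5 K E"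
      unfolding disjoint_cycles_4_5_def using S_cycle
      by (intro exI[of _ "[p, q, r, t]"] exI[of _ "[s1, s2, s3, s4, s5]"]) auto
    then show False
      using none by simp
  qed
  have sink: "(\<exists>y\<in>A. \<forall>x\<in>A - {y}. E x y) \<or>
      (\<exists>a b c. is_cycle A E [a, b, c] \<and> (\<forall>x\<in>A - {a, b, c}. E x a \<and> E x b \<and> E x c))"
    if "A \<subseteq> X" "A \<noteq> {}" for A
    using sink_point_or_triangle[of A] that X(1) no_4_cycle[OF that(1)] by blast
  \<comment> \<open>\<open>P\<close> is an initial part of \<open>X\<close> in the order of its
    components. Since \<open>K\<close> is strong, some arc enters \<open>P\<close>; it cannot come
    from the rest of \<open>X\<close>, so it starts in \<open>S\<close>, and the 5-cycle is rotated
    to begin at its tail.\<close>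
  have enter: "\<exists>a b c d e. \<exists>p\<in>P. is_cycle K E [a, b, c, d, e] \<and> {a, b, c, d, e} = S \<and> E a p"
    if P: "P \<subseteq> X" "P \<noteq> {}" "\<forall>y\<in>X - P. \<forall>p\<in>P. E p y" for P
  proof -
    have "s1 \<in> K - P"
      using P(1) SK by (auto simp: X_def S_def)
    moreover have "K - P \<subset> K"
      using P(1,2) X(2) by blast
    ultimately obtain s p where sp: "s \<in> K - P" "p \<in> P" "E s p"
      using strongD[OF K(2), of "K - P"] by blast
    then have "s \<in> S"
      using P(3) arc_asym unfolding X_def by blast
    then show ?thesis
      using rotate_5_cycle[OF S_cycle, of s] sp(2,3) unfolding S_def by metis
  qed
  \<comment> \<open>Common frame for all six certificates: the list is the 5-cycle followed by
    \<open>ys\<close>, and \<open>P\<close> is the rest of \<open>X\<close>.\<close>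
  have contradiction_by: False
    if cyc: "is_cycle K E [a, b, c, d, e]" "{a, b, c, d, e} = S"
      and ys: "set ys \<union> P = X" "set ys \<inter> P = {}" "distinct ys" "length ys \<le> 5"
      and chk: "check n ps t" "n = 5 + length ys"
      and ps: "\<forall>(i, j)\<in>set ps. holds E ([a, b, c, d, e] @ ys) P i j" for a b c d e ys P n ps t
  proof -
    let ?xs = "[a, b, c, d, e] @ ys"
    have set_xs: "set ?xs = S \<union> set ys"
      using cyc(2) by auto
    have disj: "S \<inter> set ys = {}" "S \<inter> P = {}"
      using ys(1) unfolding X_def by auto
    have "K = set ?xs \<union> P" "set ?xs \<inter> P = {}"
      using set_xs ys(1,2) SK disj unfolding X_def by auto
    moreover have "distinct ?xs"
      using cyc ys(3) disj(1) by (auto simp: is_cycle_5)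
    moreover have "length ?xs \<le> 10" "length ?xs = n"
      using ys(4) chk(2) by auto
    ultimately have "disjoint_cycles_4_5 K E"
      using check_sound[of K ?xs P ps t, OF _ K(1) _ _ _ deg _ ps] chk(1) by metis
    then show False
      using none by simp
  qed
  \<comment> \<open>The components of \<open>X\<close> are peeled off from the sink end; the first
    possibility is that the last one is a triangle.\<close>
  have no_triangle_sink: "\<not> (is_cycle X E [t0, t1, t2] \<and>
      (\<forall>x\<in>X - {t0, t1, t2}. E x t0 \<and> E x t1 \<and> E x t2))" for t0 t1 t2
  proof
    assume T: "is_cycle X E [t0, t1, t2] \<and> (\<forall>x\<in>X - {t0, t1, t2}. E x t0 \<and> E x t1 \<and> E x t2)"
    let ?P = "X - {t0, t1, t2}"
    have "?P \<noteq> {}"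
      using large[of "[t0, t1, t2]"] T by (auto simp: is_cycle_3)
    then obtain a b c d e p where s: "is_cycle K E [a, b, c, d, e]" "{a, b, c, d, e} = S" "E a p"
      and p: "p \<in> ?P"
      using enter[of ?P] T by blast
    show False
      by (rule contradiction_by[OF s(1,2) _ _ _ _ check_triangle, of "[p, t0, t1, t2]" "?P - {p}"])
        (use T p s in \<open>auto simp: is_cycle_3 is_cycle_5 arcs_triangle_def holds_def\<close>)
  qed
  have "X \<noteq> {}"
    using large[of "[]"] by simp
  then obtain y where y: "y \<in> X" "\<forall>x\<in>X - {y}. E x y"
    using sink[of X] no_triangle_sink by blast
  have "X - {y} \<noteq> {}"
    using large[of "[y]"] y by auto
  \<comment> \<open>The sink \<open>y\<close> is a single vertex; now the component before it is
    examined.\<close>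
  then consider
    (triangle) t0 t1 t2 where "is_cycle (X - {y}) E [t0, t1, t2]"
      "\<forall>x\<in>X - {y} - {t0, t1, t2}. E x t0 \<and> E x t1 \<and> E x t2"
    | (point) z where "z \<in> X - {y}" "\<forall>x\<in>X - {y} - {z}. E x z"
    using sink[of "X - {y}"] by blast
  then show False
  proof cases
    case triangle
    let ?P = "X - {t0, t1, t2, y}"
    show False
    proof (cases "?P = {}")
      case True
      then have eq: "X = {t0, t1, t2, y}"
        using triangle(1) y(1) by (auto simp: is_cycle_3)
      \<comment> \<open>With nothing before the triangle, the arc from \<open>S\<close> must enter
        the triangle itself. Rotating the triangle puts the head of that arc at position 5.\<close>
      obtain a b c d e p where s: "is_cycle K E [a, b, c, d, e]" "{a, b, c, d, e} = S" "E a p"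
        and p: "p \<in> {t0, t1, t2}"
        using enter[of "{t0, t1, t2}"] eq y(2) triangle(1) by (auto simp: is_cycle_3)
      obtain q r where pqr: "is_cycle (X - {y}) E [p, q, r]" "{p, q, r} = {t0, t1, t2}"
        using rotate_triangle[OF triangle(1) p] by metis
      have "X = {p, q, r, y}"
        using eq pqr(2) by auto
      then show False
        by (intro contradiction_by[OF s(1,2) _ _ _ _ check_triangle_point_only, of "[p, q, r, y]" "{}"])
          (use y pqr s in \<open>auto simp: is_cycle_3 is_cycle_5 arcs_triangle_point_only_def holds_def\<close>)
    next
      case False
      then obtain a b c d e p where s: "is_cycle K E [a, b, c, d, e]" "{a, b, c, d, e} = S" "E a p"
        and p: "p \<in> ?P"
        using enter[of ?P] triangle(2) y by blast
      show False
        by (rule contradiction_by[OF s(1,2) _ _ _ _ check_triangle_point, of "[t0, t1, t2, y]" ?P])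
          (use y triangle p s in \<open>auto simp: is_cycle_3 is_cycle_5 arcs_triangle_point_def holds_def\<close>)
    qed
  next
    case point
    have "X - {y, z} \<noteq> {}"
      using large[of "[y, z]"] y point by auto
    \<comment> \<open>After two single vertices \<open>y\<close> and \<open>z\<close>, the third
      component from the end decides between the remaining configurations.\<close>
    then consider
      (triangle) t0 t1 t2 where "is_cycle (X - {y, z}) E [t0, t1, t2]"
        "\<forall>x\<in>X - {y, z} - {t0, t1, t2}. E x t0 \<and> E x t1 \<and> E x t2"
      | (point') w where "w \<in> X - {y, z}" "\<forall>x\<in>X - {y, z} - {w}. E x w"
      using sink[of "X - {y, z}"] by blast
    then show False
    proof cases
      case triangle
      let ?P = "X - {t0, t1, t2, z, y}"
      show False
      proof (cases "?P = {}")
        case True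
        then have eq: "X = {t0, t1, t2, z, y}"
          using triangle(1) y(1) point(1) by (auto simp: is_cycle_3)
        obtain a b c d e p where s: "is_cycle K E [a, b, c, d, e]" "{a, b, c, d, e} = S" "E a p"
          and p: "p \<in> {t0, t1, t2}"
          using enter[of "{t0, t1, t2}"] eq y(2) point(2) triangle(1) by (auto simp: is_cycle_3)
        obtain q r where pqr: "is_cycle (X - {y, z}) E [p, q, r]" "{p, q, r} = {t0, t1, t2}"
          using rotate_triangle[OF triangle(1) p] by metis
        have "X = {p, q, r, z, y}"
          using eq pqr(2) by auto
        then show False
          by (intro contradiction_by[OF s(1,2) _ _ _ _ check_triangle_points_only, of "[p, q, r, z, y]" "{}"])
            (use y point pqr s in
              \<open>auto simp: is_cycle_3 is_cycle_5 arcs_triangle_points_only_def holds_def\<close>)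
      next
        case False
        then obtain a b c d e p where s: "is_cycle K E [a, b, c, d, e]" "{a, b, c, d, e} = S" "E a p"
          and p: "p \<in> ?P"
          using enter[of ?P] triangle(2) y point by blast
        show False
          by (rule contradiction_by[OF s(1,2) _ _ _ _ check_triangle_points, of "[t0, t1, t2, z, y]" ?P])
            (use y point triangle p s in
              \<open>auto simp: is_cycle_3 is_cycle_5 arcs_triangle_points_def holds_def\<close>)
      qed
    next
      case point'
      let ?P = "X - {w, z, y}"
      have "?P \<noteq> {}"
        using large[of "[w, z, y]"] y point point' by auto
      then obtain a b c d e p where s: "is_cycle K E [a, b, c, d, e]" "{a, b, c, d, e} = S" "E a p"
        and p: "p \<in> ?P"
        using enter[of ?P] y point point' by blast
      show False
        by (rule contradiction_by[OF s(1,2) _ _ _ _ check_points, of "[p, w, z, y]" "?P - {p}"])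
          (use y point point' p s in \<open>auto simp: is_cycle_5 arcs_points_def holds_def\<close>)
    qed
  qed
qed

section \<open>Three disjoint cycles of different lengths\<close>

lemma card_arcs_triangle:
  assumes T: "is_cycle V E [t1, t2, t3]" "v \<in> V - {t1, t2, t3}"
  shows "card {t \<in> {t1, t2, t3}. E v t} + card {t \<in> {t1, t2, t3}. E t v} = 3"
proof -
  let ?T = "{t1, t2, t3}"
  have "card {t \<in> ?T. E v t} + card {t \<in> ?T. E t v} = card ({t \<in> ?T. E v t} \<union> {t \<in> ?T. E t v})"
    using arc_asym by (subst card_Un_disjoint) auto
  also have "{t \<in> ?T. E v t} \<union> {t \<in> ?T. E t v} = ?T"
    using T arc_total[of v] by (auto simp: is_cycle_3)
  also have "card ?T = 3"
    using T(1) by (auto simp: is_cycle_3)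
  finally show ?thesis .
qed

lemma small_sink_component:
  assumes T: "is_cycle V E [t1, t2, t3]"
    and K: "K \<subseteq> V - {t1, t2, t3}" "strong E K" "card K \<le> 8"
    and dom: "\<And>k x. k \<in> K \<Longrightarrow> x \<in> V - {t1, t2, t3} - K \<Longrightarrow> E x k"
    and deg: "\<And>v. v \<in> V \<Longrightarrow> 6 \<le> card {w \<in> V. E v w}"
  shows "three_disjoint_cycles_diff_lengths V E"
proof -
  define T where "T = {t1, t2, t3}"
  define U where "U = V - T - K"
  define e where "e k = card {t \<in> T. E t k}" for k
  have TV: "T \<subseteq> V" and finT: "finite T"
    using T by (auto simp: T_def is_cycle_3)
  have KV: "K \<subseteq> V" "K \<inter> T = {}" and finK: "finite K"
    using K(1) finite_subset_V[of K] by (auto simp: T_def)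
  have finU: "finite U"
    using finite_V by (simp add: U_def)
  have UK: "E u k" if "u \<in> U" "k \<in> K" for u k
    using dom that by (simp add: U_def T_def)
  have arcs_T: "card {t \<in> T. E k t} + e k = 3" if "k \<in> K" for k
    using card_arcs_triangle[OF T, of k] that K(1) KV(1) by (auto simp: T_def e_def)
  \<comment> \<open>Out-neighbours of \<open>k\<close> lie in \<open>K\<close> or \<open>T\<close>,
    as \<open>U\<close> dominates \<open>K\<close>; only \<open>3 - e k\<close> of them lie in
    \<open>T\<close>.\<close>
  have deg_K: "3 + e k \<le> card {w \<in> K. E k w}" if k: "k \<in> K" for k
  proof -
    have "{w \<in> V. E k w} = {w \<in> K. E k w} \<union> {w \<in> T. E k w}"
      using k KV TV UK arc_asym unfolding U_def by blast
    then have "card {w \<in> V. E k w} \<le> card {w \<in> K. E k w} + card {w \<in> T. E k w}"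
      using card_Un_le by metis
    moreover have "6 \<le> card {w \<in> V. E k w}"
      using deg k KV(1) by blast
    ultimately show ?thesis
      using arcs_T[OF k] by linarith
  qed
  \<comment> \<open>Summing gives \<open>6 * card K + 2 * (\<Sum>k\<in>K. e k) \<le> card K * (card
    K - 1)\<close>. This forces at least 7 vertices, with slack 0 for 7 and slack 8 for 8.\<close>
  have "(\<Sum>k\<in>K. 3 + e k) \<le> (\<Sum>k\<in>K. card {w \<in> K. E k w})"
    by (rule sum_mono) (rule deg_K)
  then have "6 * card K + 2 * (\<Sum>k\<in>K. e k) \<le> card K * (card K - 1)"
    using sum_outdeg[OF KV(1)] by (simp add: sum.distrib)
  moreover have "card K \<noteq> 0"
    using K(2) finK by (simp add: strong_def)
  moreover have "card K \<in> {0..8}"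
    using K(3) by simp
  then have "card K \<in> {0, 1, 2, 3, 4, 5, 6, 7, 8}"
    by (simp add: atLeastAtMost_insertL) auto
  ultimately have size: "card K = 7 \<and> (\<Sum>k\<in>K. e k) = 0 \<or> card K = 8 \<and> (\<Sum>k\<in>K. e k) \<le> 4"
    by (elim insertE) auto
  then have "5 \<le> card K"
    by auto
  then obtain p q r s t where C: "is_cycle K E [p, q, r, s, t]"
    using strong_card_ge_5_cycle[OF K(2) KV(1)] by metis
  define R where "R = K - {p, q, r, s, t}"
  have card_R: "card R = card K - 5" and RK: "R \<subseteq> K"
    using C finK by (auto simp: R_def is_cycle_5 card_Diff_subset)
  have sum_le: "(\<Sum>k\<in>A. e k) \<le> (\<Sum>k\<in>K. e k)" if "A \<subseteq> K" for A
    by (rule sum_mono2[OF finK that]) simp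
  \<comment> \<open>\<open>R\<close> has 2 or 3 vertices. If all had \<open>e\<close> at least 2,
    the sum would be at least 4 or 6, against the bounds 0 and 4.\<close>
  obtain k where k: "k \<in> R" "e k \<le> 1"
  proof (rule ccontr)
    assume "\<not> thesis"
    then have "(\<Sum>k\<in>R. 2) \<le> (\<Sum>k\<in>R. e k)"
      using that by (intro sum_mono) fastforce
    then show False
      using sum_le[OF RK] size card_R by auto
  qed
  \<comment> \<open>Now 1 or 2 vertices are left, and values of at least 3 would sum to at least 3
    or 6, against the same bounds.\<close>
  obtain k' where k': "k' \<in> R - {k}" "e k' \<le> 2"
  proof (rule ccontr)
    assume "\<not> thesis"
    then have "(\<Sum>k\<in>R - {k}. 3) \<le> (\<Sum>k\<in>R - {k}. e k)"
      using that by (intro sum_mono) fastforce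
    moreover have "card (R - {k}) = card K - 6"
      using k(1) card_R by simp
    moreover have "R - {k} \<subseteq> K"
      using RK by blast
    ultimately show False
      using sum_le[of "R - {k}"] size by auto
  qed
  have "k \<in> K" "k' \<in> K"
    using k k' RK by auto
  then have "1 \<le> card {t \<in> T. E k t}" "1 \<le> card {t \<in> T. E k' t}"
    "2 \<le> card {t \<in> T. E k t} \<or> 2 \<le> card {t \<in> T. E k' t}"
    using arcs_T[of k] arcs_T[of k'] k(2) k'(2) by linarith+
  then obtain x y where xy: "x \<in> {t \<in> T. E k t}" "y \<in> {t \<in> T. E k' t}" "x \<noteq> y"
    by (rule exists_distinct_representatives)
  have "x \<in> {t1, t2, t3}"
    using xy(1) by (simp add: T_def)
  then obtain x' x'' where rot: "is_cycle V E [x, x', x'']" "{x, x', x''} = T"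
    unfolding T_def by (rule rotate_triangle[OF T])
  \<comment> \<open>Two distinct vertices of a triangle are consecutive in one of the two orders.
    They are named so that \<open>c\<close> directly precedes \<open>a\<close>, swapping
    \<open>k\<close> and \<open>k'\<close> if necessary.\<close>
  obtain a b c l m where abc: "is_cycle V E [a, b, c]" "{a, b, c} = T"
    and lm: "l \<in> R" "m \<in> R" "l \<noteq> m" "E l a" "E m c"
  proof (cases "y = x''")
    case True
    show thesis
      by (rule that[of x x' x'' k k']) (use True rot xy k k' in auto)
  next
    case False
    then have "y = x'"
      using xy rot(2) by auto
    show thesis
      by (rule that[of x' x'' x k' k]) (use \<open>y = x'\<close> rot xy k k' in \<open>auto simp: is_cycle_3\<close>)
  qed
  \<comment> \<open>A triangle vertex has only its successor \<open>w\<close> as out-neighbour in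
    \<open>T\<close>, so five further out-neighbours lie in \<open>K\<close> or
    \<open>U\<close>.\<close>
  have deg_T: "5 \<le> card {k \<in> K. E v k} + card {u \<in> U. E v u}"
    if "v \<in> T" "{w \<in> T. E v w} \<subseteq> {w}" for v w
  proof -
    have "{w \<in> V. E v w} \<subseteq> {w} \<union> ({k \<in> K. E v k} \<union> {u \<in> U. E v u})"
      using that unfolding U_def by blast
    then have "card {w \<in> V. E v w} \<le> card ({w} \<union> ({k \<in> K. E v k} \<union> {u \<in> U. E v u}))"
      by (rule card_mono[rotated]) (simp add: finK finU)
    also have "\<dots> \<le> card {w} + card ({k \<in> K. E v k} \<union> {u \<in> U. E v u})"
      by (rule card_Un_le)
    also have "\<dots> \<le> card {w} + (card {k \<in> K. E v k} + card {u \<in> U. E v u})"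
      by (intro add_left_mono card_Un_le)
    finally have "card {w \<in> V. E v w} \<le> Suc (card {k \<in> K. E v k} + card {u \<in> U. E v u})"
      by simp
    moreover have "6 \<le> card {w \<in> V. E v w}"
      using deg that(1) TV by blast
    ultimately show ?thesis
      by linarith
  qed
  \<comment> \<open>Counting the arcs from \<open>T\<close> to \<open>K\<close> at either end shows
    that there are at most 4. So \<open>b\<close> and \<open>c\<close> each reach \<open>U\<close>,
    and together they send at least 6 arcs there.\<close>
  have "(\<Sum>v\<in>T. card {k \<in> K. E v k}) = (\<Sum>k\<in>K. e k)"
    using sum.swap_restrict[of T K "\<lambda>_ _. 1::nat" E] finT finK by (simp add: e_def)
  moreover have "(\<Sum>v\<in>T. card {k \<in> K. E v k}) =
      card {k \<in> K. E a k} + card {k \<in> K. E b k} + card {k \<in> K. E c k}"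
    using abc by (auto simp: is_cycle_3)
  ultimately have "card {k \<in> K. E b k} + card {k \<in> K. E c k} \<le> 4"
    using size by auto
  moreover have "5 \<le> card {k \<in> K. E b k} + card {u \<in> U. E b u}"
    by (rule deg_T[of b c]) (use abc arc_asym arc_irrefl in \<open>auto simp: is_cycle_3\<close>)
  moreover have "5 \<le> card {k \<in> K. E c k} + card {u \<in> U. E c u}"
    by (rule deg_T[of c a]) (use abc arc_asym arc_irrefl in \<open>auto simp: is_cycle_3\<close>)
  ultimately have "1 \<le> card {u \<in> U. E b u}" "1 \<le> card {u \<in> U. E c u}"
    "2 \<le> card {u \<in> U. E b u} \<or> 2 \<le> card {u \<in> U. E c u}"
    by linarith+
  then obtain u u' where u: "u \<in> {u \<in> U. E b u}" "u' \<in> {u \<in> U. E c u}" "u \<noteq> u'"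
    by (rule exists_distinct_representatives)
  have lm_K: "l \<in> K" "m \<in> K" "l \<notin> {p, q, r, s, t}" "m \<notin> {p, q, r, s, t}"
    using lm by (auto simp: R_def)
  have ab_T: "a \<in> T" "b \<in> T" "c \<in> T"
    using abc(2) by auto
  have disj: "T \<inter> K = {}" "T \<inter> U = {}" "U \<inter> K = {}" and UV: "U \<subseteq> V"
    using KV(2) by (auto simp: U_def)
  have C_K: "{p, q, r, s, t} \<subseteq> K"
    using C by (simp add: is_cycle_5)
  \<comment> \<open>The arcs from \<open>u'\<close> to \<open>m\<close> and from \<open>u\<close> to
    \<open>l\<close> exist because \<open>U\<close> dominates \<open>K\<close>; those from
    \<open>m\<close> to \<open>c\<close> and from \<open>l\<close> to \<open>a\<close> were chosen
    above.\<close>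
  have "is_cycle V E [c, u', m]"
    unfolding is_cycle_3 using u ab_T lm lm_K disj TV KV(1) UV UK by auto
  moreover have "is_cycle V E [a, b, u, l]"
    unfolding is_cycle_4 using abc(1) u ab_T lm lm_K disj TV KV(1) UV UK by (auto simp: is_cycle_3)
  moreover have "is_cycle V E [p, q, r, s, t]"
    using C KV(1) by (rule is_cycle_mono)
  moreover have "set [c, u', m] \<inter> set [a, b, u, l] = {}"
    using abc(1) u ab_T lm lm_K disj by (auto simp: is_cycle_3)
  moreover have "set [c, u', m] \<inter> set [p, q, r, s, t] = {}" "set [a, b, u, l] \<inter> set [p, q, r, s, t] = {}"
    using u ab_T lm_K disj C_K by auto
  ultimately show ?thesis
    unfolding three_disjoint_cycles_diff_lengths_def
    by (intro exI[of _ "[c, u', m]"] exI[of _ "[a, b, u, l]"] exI[of _ "[p, q, r, s, t]"]) simp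
qed

text \<open>The triangle is taken from a sink component of \<open>V\<close>; the size of a sink
  component of the rest selects one of the two cases.\<close>

lemma three_disjoint_cycles:
  assumes deg: "\<And>v. v \<in> V \<Longrightarrow> 6 \<le> card {w \<in> V. E v w}"
  shows "three_disjoint_cycles_diff_lengths V E"
proof -
  have "V \<noteq> {}"
    using tournament by (simp add: tournament_def)
  then obtain W where W: "W \<subseteq> V" "strong E W" "\<And>w x. w \<in> W \<Longrightarrow> x \<in> V - W \<Longrightarrow> E x w"
    using sink_component[of V] by blast
  obtain v where v: "v \<in> W"
    using W(2) by (auto simp: strong_def)
  have deg_v: "6 \<le> card {w \<in> V. E v w}"
    using deg v W(1) by blast
  then have "{w \<in> V. E v w} \<noteq> {}"
    by (metis card.empty not_numeral_le_zero)
  then obtain w where "w \<in> V" "E v w"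
    by blast
  \<comment> \<open>No arc leaves the sink component, so an out-neighbour of \<open>v\<close> is a
    second vertex in it.\<close>
  then have "w \<in> W" "w \<noteq> v"
    using W(3)[OF v, of w] arc_asym arc_irrefl by blast+
  then have "W \<noteq> {v}"
    by blast
  then obtain t1 t2 t3 where "is_cycle W E [t1, t2, t3]"
    using strong_triangle[OF W(2,1) v] by blast
  then have T: "is_cycle V E [t1, t2, t3]"
    using W(1) by (rule is_cycle_mono)
  let ?T = "{t1, t2, t3}"
  have "card {w \<in> V. E v w} \<le> card V"
    using finite_V by (intro card_mono) auto
  then have "6 \<le> card V"
    using deg_v by linarith
  moreover have "card ?T = 3"
    using T by (simp add: is_cycle_3)
  ultimately have "\<not> V \<subseteq> ?T"
    using card_mono[of ?T V] by auto
  then obtain K where K: "K \<subseteq> V - ?T" "strong E K" "\<And>k x. k \<in> K \<Longrightarrow> x \<in> V - ?T - K \<Longrightarrow> E x k"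
    using sink_component[of "V - ?T"] by blast
  show ?thesis
  proof (cases "card K \<le> 8")
    case True
    then show ?thesis
      using small_sink_component[OF T K(1,2) _ K(3) deg] by blast
  next
    case False
    have finK: "finite K"
      using K(1) finite_subset_V by blast
    \<comment> \<open>No arc leads from \<open>K\<close> to vertices outside \<open>K\<close> and
      the triangle, so at most three out-neighbours are lost.\<close>
    have "3 \<le> card {w \<in> K. E k w}" if k: "k \<in> K" for k
    proof -
      have "{w \<in> V. E k w} \<subseteq> {w \<in> K. E k w} \<union> ?T"
        using K(3)[OF k] arc_asym by blast
      then have "card {w \<in> V. E k w} \<le> card ({w \<in> K. E k w} \<union> ?T)"
        using finK by (intro card_mono) auto
      also have "\<dots> \<le> card {w \<in> K. E k w} + card ?T"
        by (rule card_Un_le)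
      finally have "card {w \<in> V. E k w} \<le> card {w \<in> K. E k w} + card ?T" .
      moreover have "6 \<le> card {w \<in> V. E k w}"
        using deg k K(1) by blast
      ultimately show ?thesis
        using \<open>card ?T = 3\<close> by linarith
    qed
    then have "disjoint_cycles_4_5 K E"
      using strong_disjoint_cycles_4_5[of K] K(1,2) False by auto
    then obtain c d where cd: "is_cycle K E c" "is_cycle K E d" "length c = 4" "length d = 5"
      "set c \<inter> set d = {}"
      unfolding disjoint_cycles_4_5_def by blast
    have "set c \<subseteq> K" "set d \<subseteq> K" "is_cycle V E c" "is_cycle V E d"
      using cd(1,2) K(1) by (auto simp: is_cycle_def)
    moreover have "set [t1, t2, t3] \<inter> K = {}"
      using K(1) by auto
    ultimately show ?thesis
      unfolding three_disjoint_cycles_diff_lengths_def using T cd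
      by (intro exI[of _ "[t1, t2, t3]"] exI[of _ c] exI[of _ d]) auto
  qed
qed

end

section \<open>Sharpness\<close>

text \<open>The circulant tournament on the residues modulo 11 with connection set 1 to 5. Adding 11
  keeps the natural subtraction from being truncated.\<close>

definition rotational :: "nat \<Rightarrow> nat \<Rightarrow> bool" where
  "rotational x y \<longleftrightarrow> x < 11 \<and> y < 11 \<and> (y + 11 - x) mod 11 \<in> {1..5}"

lemma rotational_tournament: "tournament {..<11} rotational"
proof -
  have "\<forall>x\<in>{..<11}. \<forall>y\<in>{..<11}. x \<noteq> y \<longrightarrow> (rotational x y \<longleftrightarrow> \<not> rotational y x)"
    unfolding rotational_def by code_simp
  then show ?thesis
    by (auto simp: tournament_def rotational_def lessThan_empty_iff)
qed

lemma rotational_outdeg: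
  assumes "v < 11"
  shows "outdeg {..<11} rotational v = 5"
proof -
  have "\<forall>v\<in>{..<11}. length (filter (rotational v) [0..<11]) = 5"
    unfolding rotational_def by code_simp
  moreover have "{w \<in> {..<11}. rotational v w} = set (filter (rotational v) [0..<11])"
    by auto
  ultimately show ?thesis
    using assms by (simp add: outdeg_def distinct_card del: set_filter)
qed

text \<open>Three different lengths, each at least 3, sum to at least
  \<open>3 + 4 + 5\<close>.\<close>

lemma three_disjoint_cycles_card:
  assumes "tournament V E" "three_disjoint_cycles_diff_lengths V E"
  shows "12 \<le> card V"
proof -
  obtain c1 c2 c3 where c: "is_cycle V E c1" "is_cycle V E c2" "is_cycle V E c3"
    "set c1 \<inter> set c2 = {}" "set c1 \<inter> set c3 = {}" "set c2 \<inter> set c3 = {}"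
    "length c1 \<noteq> length c2" "length c1 \<noteq> length c3" "length c2 \<noteq> length c3"
    using assms(2) unfolding three_disjoint_cycles_diff_lengths_def by blast
  \<comment> \<open>\<open>is_cycle\<close> admits length 2, but such a cycle would consist of two
    opposite arcs.\<close>
  have len: "3 \<le> length c" if c: "is_cycle V E c" for c
  proof (rule ccontr)
    assume "\<not> 3 \<le> length c"
    then have "length c = 2"
      using c by (simp add: is_cycle_def)
    then have "E (c ! 0) (c ! 1)" "E (c ! 1) (c ! 0)"
      using c by (auto simp: is_cycle_def dest: spec[of _ 0] spec[of _ 1])
    then show False
      using assms(1) unfolding tournament_def by blast
  qed
  have "length c1 + length c2 + length c3 = card (set c1 \<union> set c2 \<union> set c3)"
    using c by (subst card_Un_disjoint; (subst card_Un_disjoint)?) (auto simp: is_cycle_def distinct_card)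
  also have "\<dots> \<le> card V"
  proof (rule card_mono)
    show "finite V"
      using assms(1) by (simp add: tournament_def)
    show "set c1 \<union> set c2 \<union> set c3 \<subseteq> V"
      using c(1-3) by (simp add: is_cycle_def)
  qed
  finally show ?thesis
    using len[OF c(1)] len[OF c(2)] len[OF c(3)] c(7,8,9) by linarith
qed

theorem theorem1p3:
  shows "(\<forall>(V :: 'a set) E. tournament V E \<and> (\<forall>v\<in>V. 6 \<le> outdeg V E v)
            \<longrightarrow> three_disjoint_cycles_diff_lengths V E)
       \<and> (\<exists>(V :: nat set) E. tournament V E \<and> (\<forall>v\<in>V. 5 \<le> outdeg V E v)
            \<and> (\<exists>v\<in>V. outdeg V E v = 5) \<and> \<not> three_disjoint_cycles_diff_lengths V E)"
proof (intro conjI allI impI)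
  fix V :: "'a set" and E
  assume "tournament V E \<and> (\<forall>v\<in>V. 6 \<le> outdeg V E v)"
  then interpret tournament_graph V E
    by unfold_locales simp
  show "three_disjoint_cycles_diff_lengths V E"
    using three_disjoint_cycles \<open>tournament V E \<and> _\<close> by (simp add: outdeg_def)
next
  have "\<not> three_disjoint_cycles_diff_lengths {..<11} rotational"
    using three_disjoint_cycles_card[OF rotational_tournament] by auto
  then show "\<exists>(V :: nat set) E. tournament V E \<and> (\<forall>v\<in>V. 5 \<le> outdeg V E v)
      \<and> (\<exists>v\<in>V. outdeg V E v = 5) \<and> \<not> three_disjoint_cycles_diff_lengths V E"
    using rotational_tournament rotational_outdeg
    by (intro exI[of _ "{..<11}"] exI[of _ rotational]) (auto intro: exI[of _ 0])
qed

end
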